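(* Let $1\leq m<k\leq n$ be integers, let $\lambda_1,\ldots,\lambda_n>0$ and $\gamma>0$. Let $X_1,\ldots,X_n$ be independent exponential random variables with rates $\lambda_1,\ldots,\lambda_n$ respectively, and let $Y_1,\ldots,Y_n$ be independent exponential random variables with common rate $\gamma$. Let $X_{j:n}$ and $Y_{j:n}$ denote the $j$th order statistics of the two samples. Let $\leq_{\rm order}$ be any one of the orders $\leq_{\rm st}$, $\leq_{\rm hr}$, $\leq_{\rm disp}$. Then $$Y_{k:n}-Y_{m:n}\leq_{\rm order} X_{k:n}-X_{m:n}$$ if and only if $$\binom{n-m}{k-m}\gamma^{k-m}\geq \sum_{\mathbf{r}} s_{k-m}^{[\mathbf{r}]}(\lambda)\prod_{j=1}^m \frac{\lambda_{r_j}}{\Lambda-\sum_{i=1}^{j-1}\lambda_{r_i}},$$ where the outer sum is over all $\mathbf{r}=(r_1,\ldots,r_m)$ that are permutations of $\{1,\ldots,n\}$ using $m$ at a time (i.e. ordered $m$-tuples of distinct elements of $\{1,\ldots,n\}$), $\lambda=(\lambda_1,\ldots,\lambda_n)$, $\Lambda=\sum_{i=1}^n\lambda_i$, and $s_{k-m}^{[\mathbf{r}]}(\lambda)=s_{k-m}(\lambda\backslash\{\lambda_{r_1},\ldots,\lambda_{r_m}\})$ is the $(k-m)$th elementary symmetric function of the $n-m$ numbers $\lambda_i$ with $i\in\{1,\ldots,n\}\setminus\{r_1,\ldots,r_m\}$.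
   Context: An exponential random variable with rate $\lambda>0$ has distribution function $1-e^{-\lambda x}$, $x\geq 0$. The $j$th order statistic of a sample of size $n$ is its $j$th smallest value (so $X_{1:n}$ is the minimum and $X_{n:n}$ the maximum). The $p$th elementary symmetric function of numbers $a_1,\ldots,a_N$ is $s_p(a_1,\ldots,a_N)=\sum_{1\leq i_1<\cdots<i_p\leq N}a_{i_1}\cdots a_{i_p}$. The removal $\lambda\backslash\{\lambda_{r_1},\ldots,\lambda_{r_m}\}$ is by index (only the entries at positions $r_1,\ldots,r_m$ are deleted, even if some rates coincide). For random variables $U,V$ supported on $(0,\infty)$ with continuous distribution functions $F,G$ respectively: $U\leq_{\rm st}V$ (usual stochastic order) means that $F(x)\geq G(x)$ for all $x$; $U\leq_{\rm hr}V$ (hazard rate order) means that $(1-G(x))/(1-F(x))$ is increasing (in the weak sense) in $x>0$; $U\leq_{\rm disp}V$ (dispersive order) means that $F^{-1}(v)-F^{-1}(u)\leq G^{-1}(v)-G^{-1}(u)$ for all $0<u<v<1$, where $F^{-1},G^{-1}$ are the right continuous inverses. These orders depend only on the distributions of $U$ and $V$. *)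

theory Defs
  imports "HOL-Probability.Probability"
begin

definition order_statistic :: "nat \<Rightarrow> nat \<Rightarrow> (nat \<Rightarrow> real) \<Rightarrow> real" where
  "order_statistic j n x = sort (map x [1..<Suc n]) ! (j - 1)"
  \<comment> \<open>for \<open>1 \<le> j \<le> n\<close>, the \<open>j\<close>-th smallest of \<open>x 1, \<dots>, x n\<close>, counted with multiplicity\<close>

definition elem_sym :: "nat \<Rightarrow> 'i set \<Rightarrow> ('i \<Rightarrow> real) \<Rightarrow> real" where
  "elem_sym p I a = (\<Sum>S | S \<subseteq> I \<and> card S = p. \<Prod>i\<in>S. a i)"
  \<comment> \<open>the family \<open>a\<close> is indexed by the finite set \<open>I\<close>, so equal values at different
     indices are kept apart\<close>

definition st_order :: "real measure \<Rightarrow> real measure \<Rightarrow> bool" where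
  "st_order \<mu> \<nu> \<longleftrightarrow> (\<forall>x. cdf \<nu> x \<le> cdf \<mu> x)"

text \<open>
  In the hazard rate order the quotient of the survival functions is only considered where its
  denominator is nonzero. This amounts to reading \<open>a / 0\<close> as infinity for \<open>a > 0\<close> and ignoring
  points where both survival functions vanish; Isabelle's \<open>a / 0 = 0\<close> never enters.
\<close>

definition hr_order :: "real measure \<Rightarrow> real measure \<Rightarrow> bool" where
  "hr_order \<mu> \<nu> \<longleftrightarrow>
     mono_on {x. 0 < x \<and> cdf \<mu> x < 1} (\<lambda>x. (1 - cdf \<nu> x) / (1 - cdf \<mu> x))"

definition right_cont_inverse :: "(real \<Rightarrow> real) \<Rightarrow> real \<Rightarrow> real" where
  "right_cont_inverse F u = Inf {x. u < F x}"
  \<comment> \<open>strict inequality gives the right continuous inverse of a distribution function;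
     \<open>u \<le> F x\<close> would give the left continuous one\<close>

definition disp_order :: "real measure \<Rightarrow> real measure \<Rightarrow> bool" where
  "disp_order \<mu> \<nu> \<longleftrightarrow>
     (\<forall>u v. 0 < u \<and> u < v \<and> v < 1 \<longrightarrow>
        right_cont_inverse (cdf \<mu>) v - right_cont_inverse (cdf \<mu>) u
          \<le> right_cont_inverse (cdf \<nu>) v - right_cont_inverse (cdf \<nu>) u)"

end

theory Submission
  imports Defs
begin

text \<open>
Fix \<open>p = k - m\<close> and \<open>N = n - m\<close>. By the absence of memory, once the \<open>m\<close> earliest indices have
appeared in the order \<open>r\<close>, which has probability
\<open>w r = (\<Prod>j. \<lambda>\<^sub>r\<^sub>j / (\<Lambda> - \<Sum>i<j. \<lambda>\<^sub>r\<^sub>i))\<close>, the remaining waiting times start afresh. Hence the spacing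
\<open>X\<^sub>k\<^sub>:\<^sub>n - X\<^sub>m\<^sub>:\<^sub>n\<close> has the distribution function \<open>F = (\<Sum>r. w r * F\<^sub>r)\<close>, where \<open>F\<^sub>r\<close> belongs to the
\<open>p\<close>-th order statistic of the variables outside \<open>r\<close> (\<open>cdf_exponential_spacing\<close>). In the homogeneous
sample all \<open>F\<^sub>r\<close> agree and the spacing has the distribution function \<open>G (\<gamma> x)\<close>, with \<open>G\<close> that of the
\<open>p\<close>-th order statistic of \<open>N\<close> unit exponentials.

The theorem rests on the fact that \<open>F\<close> lies above \<open>G\<close> in the star order: if \<open>F x = G (t x)\<close>, then \<open>t x / x\<close>
decreases in \<open>x\<close>. Granted this, \<open>t x / x\<close> is largest at \<open>0\<close>, where \<open>F x \<approx> s x\<^sup>p\<close> and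
\<open>G x \<approx> (N choose p) x\<^sup>p\<close> with \<open>s\<close> the right-hand side of the claimed inequality. So the
inequality says exactly that \<open>F x \<le> G (\<gamma> x)\<close> for all \<open>x\<close>, which is the usual stochastic order.
The star order upgrades it to the other two orders: quantile functions whose ratio increases and
starts above one have increasing differences, and the hazard rate order follows from a concavity
property of \<open>G\<close>. Conversely either of them implies the stochastic order by letting an argument tend
to \<open>0\<close>.

For the star order two ideas are combined. First, \<open>u \<mapsto> G (\<rho> G\<^sup>-\<^sup>1 u)\<close> is concave for \<open>\<rho> \<ge> 1\<close>
(\<open>hom_cdf_tangent\<close>), so that by Jensen's inequality mixtures of distributions above \<open>G\<close> stay above \<open>G\<close>
(\<open>star_above_mixture\<close>). This settles spacings once each \<open>F\<^sub>r\<close> is known to be above \<open>G\<close>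
(\<open>order_cdf_star\<close>), and it also drives the induction on the rank for that fact. In a sample with
total rate \<open>L\<close> the order statistic is the minimum, of rate \<open>L\<close>, plus an independent variable with
distribution function \<open>Z\<close>, a mixture of order statistics of lower rank in the samples with one variable removed;
so \<open>F' = L (Z - F)\<close>. Likewise \<open>G' = n (H - G)\<close>, with \<open>H\<close> of lower rank too. Therefore
\<open>exp (L x) (F x - G (c x))\<close> has derivative \<open>L exp (L x) (Z x - K (c x))\<close> with
\<open>K = \<theta> H + (1 - \<theta>) G\<close> and \<open>\<theta> = n c / L\<close>. For \<open>\<theta> \<le> 1\<close> the bracket changes sign at most once,
from plus to minus, because \<open>Z\<close> is above \<open>H\<close> by induction and \<open>H\<close> is above \<open>K\<close> by a direct
computation (\<open>hom_mixture_scaling\<close>); integrating from \<open>0\<close> keeps this sign pattern. For larger \<open>c\<close> there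
is nothing to cross: \<open>F x \<le> G (c x)\<close> throughout, by Maclaurin's inequality.
\<close>

section \<open>The distribution function of an order statistic\<close>

text \<open>
The probability that at least \<open>p\<close> of independent exponential variables with rates \<open>a i\<close>, \<open>i \<in> I\<close>, are at
most \<open>x\<close>, split according to the set \<open>S\<close> of those that are. The case \<open>p = 0\<close>, where it is
constantly \<open>1\<close>, lets the recursions below run without exceptions.
\<close>

definition order_cdf :: "nat \<Rightarrow> 'i set \<Rightarrow> ('i \<Rightarrow> real) \<Rightarrow> real \<Rightarrow> real" where
  "order_cdf p I a x = (\<Sum>S | S \<subseteq> I \<and> p \<le> card S.
     (\<Prod>i\<in>S. 1 - exp (- (a i * x))) * (\<Prod>i\<in>I - S. exp (- (a i * x))))"

lemma sum_subsets_insert: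
  fixes f :: "'i set \<Rightarrow> real"
  assumes "finite I" "j \<notin> I"
  shows "(\<Sum>S | S \<subseteq> insert j I \<and> P S. f S) =
    (\<Sum>S | S \<subseteq> I \<and> P S. f S) + (\<Sum>S | S \<subseteq> I \<and> P (insert j S). f (insert j S))"
proof -
  have eq: "{S. S \<subseteq> insert j I \<and> P S} =
      {S. S \<subseteq> I \<and> P S} \<union> insert j ` {S. S \<subseteq> I \<and> P (insert j S)}"
  proof (intro set_eqI iffI)
    fix S assume S: "S \<in> {S. S \<subseteq> insert j I \<and> P S}"
    show "S \<in> {S. S \<subseteq> I \<and> P S} \<union> insert j ` {S. S \<subseteq> I \<and> P (insert j S)}"
    proof (cases "j \<in> S")
      case True
      then have "S = insert j (S - {j})" by auto
      moreover have "S - {j} \<subseteq> I" using S by auto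
      ultimately show ?thesis using S by (intro UnI2 image_eqI[of _ _ "S - {j}"]) auto
    qed (use S in auto)
  qed auto
  have inj: "inj_on (insert j) {S. S \<subseteq> I \<and> P (insert j S)}"
    using assms(2) by (auto simp: inj_on_def)
  show ?thesis
    unfolding eq using assms
    by (subst sum.union_disjoint) (auto simp: sum.reindex[OF inj] o_def)
qed

lemma order_cdf_0: "finite I \<Longrightarrow> order_cdf 0 I a x = 1"
  using prod_add[of I "\<lambda>i. 1 - exp (- (a i * x))" "\<lambda>i. exp (- (a i * x))"]
  by (simp add: order_cdf_def Pow_def)

lemma order_cdf_empty: "order_cdf (Suc p) {} a x = 0"
  by (auto simp: order_cdf_def)

text \<open>
Condition on whether the variable with index \<open>j\<close> exceeds \<open>x\<close>. Most facts about \<open>order_cdf\<close> follow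
from this recursion by induction on the index set.
\<close>

lemma order_cdf_insert:
  assumes "finite I" "j \<notin> I"
  shows "order_cdf (Suc p) (insert j I) a x =
    exp (- (a j * x)) * order_cdf (Suc p) I a x + (1 - exp (- (a j * x))) * order_cdf p I a x"
proof -
  note * = sum_subsets_insert[OF assms, where P = "\<lambda>S. Suc p \<le> card S"
      and f = "\<lambda>S. (\<Prod>i\<in>S. 1 - exp (- (a i * x))) * (\<Prod>i\<in>insert j I - S. exp (- (a i * x)))"]
  have 0: "Suc p \<le> card (insert j S) \<longleftrightarrow> p \<le> card S" if "S \<subseteq> I" for S
    using assms that by (subst card_insert_disjoint) (auto intro: finite_subset)
  have 1: "(\<Prod>i\<in>insert j I - S. exp (- (a i * x))) = exp (- (a j * x)) * (\<Prod>i\<in>I - S. exp (- (a i * x)))"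
    if "S \<subseteq> I" for S
    using assms that by (subst insert_Diff_if) auto
  have 2: "(\<Prod>i\<in>insert j S. 1 - exp (- (a i * x))) = (1 - exp (- (a j * x))) * (\<Prod>i\<in>S. 1 - exp (- (a i * x)))"
    if "S \<subseteq> I" for S
    using assms that by (subst prod.insert) (auto intro: finite_subset)
  have 3: "I - insert j S = I - S" if "S \<subseteq> I" for S
    using assms that by auto
  show ?thesis
    unfolding order_cdf_def *
    by (simp add: sum_distrib_left) (auto simp: 0 1 2 3 intro!: arg_cong2[where f = "(+)"] sum.cong)
qed

lemma order_cdf_at_0: "finite I \<Longrightarrow> order_cdf (Suc p) I a 0 = 0"
  by (induction I rule: finite_induct) (auto simp: order_cdf_empty order_cdf_insert)

lemma order_cdf_Suc_0:
  "finite I \<Longrightarrow> order_cdf (Suc 0) I a x = 1 - exp (- ((\<Sum>i\<in>I. a i) * x))"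
proof (induction I rule: finite_induct)
  case (insert j I)
  have "exp (- ((\<Sum>i\<in>insert j I. a i) * x)) = exp (- (a j * x)) * exp (- ((\<Sum>i\<in>I. a i) * x))"
    using insert.hyps by (simp add: exp_add[symmetric] algebra_simps)
  then show ?case
    unfolding order_cdf_insert[OF insert.hyps] insert.IH order_cdf_0[OF insert.hyps(1)]
    by (simp add: algebra_simps)
qed (simp add: order_cdf_empty)

text \<open>
Analytically, the \<open>(p + 1)\<close>-st order statistic is the minimum plus an independent variable that,
with probability proportional to \<open>a i\<close>, is distributed like the \<open>p\<close>-th order statistic of \<open>I - {i}\<close>.
\<close>

lemma order_cdf_has_derivative:
  assumes "finite I"
  shows "(order_cdf (Suc p) I a has_real_derivative
    (\<Sum>i\<in>I. a i * (order_cdf p (I - {i}) a x - order_cdf (Suc p) I a x))) (at x)"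
  using assms
proof (induction I arbitrary: p rule: finite_induct)
  case empty
  have "order_cdf (Suc p) {} a = (\<lambda>_. 0)" by (auto simp: order_cdf_empty fun_eq_iff)
  then show ?case by simp
next
  case (insert j I)
  define q where "q = exp (- (a j * x))"
  have eq: "order_cdf (Suc p) (insert j I) a = (\<lambda>x. exp (- (a j * x)) * order_cdf (Suc p) I a x
      + (1 - exp (- (a j * x))) * order_cdf p I a x)"
    using insert by (simp add: order_cdf_insert fun_eq_iff)
  have dp: "(order_cdf p I a has_real_derivative
      (case p of 0 \<Rightarrow> 0 | Suc p' \<Rightarrow>
        (\<Sum>i\<in>I. a i * (order_cdf p' (I - {i}) a x - order_cdf p I a x)))) (at x)"
  proof (cases p)
    case 0
    have "order_cdf 0 I a = (\<lambda>_. 1)" using insert by (simp add: order_cdf_0 fun_eq_iff)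
    then show ?thesis using 0 by simp
  qed (use insert.IH in auto)
  have rem: "order_cdf p (insert j I - {i}) a x = (case p of 0 \<Rightarrow> 1 | Suc p' \<Rightarrow>
      q * order_cdf p (I - {i}) a x + (1 - q) * order_cdf p' (I - {i}) a x)" if "i \<in> I" for i
  proof -
    have "insert j I - {i} = insert j (I - {i})" using insert that by auto
    then show ?thesis
      using insert by (simp add: order_cdf_insert order_cdf_0 q_def split: nat.split)
  qed
  have remj: "insert j I - {j} = I" using insert by auto
  have "(\<Sum>i\<in>insert j I. a i * (order_cdf p (insert j I - {i}) a x - order_cdf (Suc p) (insert j I) a x))
     = a j * q * (order_cdf p I a x - order_cdf (Suc p) I a x)
      + q * (\<Sum>i\<in>I. a i * (order_cdf p (I - {i}) a x - order_cdf (Suc p) I a x))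
      + (1 - q) * (case p of 0 \<Rightarrow> 0 | Suc p' \<Rightarrow>
        (\<Sum>i\<in>I. a i * (order_cdf p' (I - {i}) a x - order_cdf p I a x)))" (is "?L = ?R")
  proof -
    define U where "U = order_cdf (Suc p) (insert j I) a x"
    have U: "U = q * order_cdf (Suc p) I a x + (1 - q) * order_cdf p I a x"
      using insert by (simp add: order_cdf_insert q_def U_def)
    have "(\<Sum>i\<in>I. a i * (order_cdf p (insert j I - {i}) a x - U))
      = (\<Sum>i\<in>I. a i * ((case p of 0 \<Rightarrow> 1 | Suc p' \<Rightarrow>
      q * order_cdf p (I - {i}) a x + (1 - q) * order_cdf p' (I - {i}) a x) - U))"
      by (intro sum.cong refl) (simp add: rem)
    also have "\<dots> = q * (\<Sum>i\<in>I. a i * (order_cdf p (I - {i}) a x - order_cdf (Suc p) I a x))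
      + (1 - q) * (case p of 0 \<Rightarrow> 0 | Suc p' \<Rightarrow>
        (\<Sum>i\<in>I. a i * (order_cdf p' (I - {i}) a x - order_cdf p I a x)))"
      unfolding U using insert.hyps
      by (cases p) (auto simp: order_cdf_0 sum_distrib_left sum.distrib[symmetric] algebra_simps intro!: sum.cong)
    moreover have "?L = a j * (order_cdf p I a x - U) + (\<Sum>i\<in>I. a i * (order_cdf p (insert j I - {i}) a x - U))"
      using insert.hyps by (simp add: remj U_def)
    moreover have "a j * (order_cdf p I a x - U) = a j * q * (order_cdf p I a x - order_cdf (Suc p) I a x)"
      by (simp add: U algebra_simps)
    ultimately show ?thesis by linarith
  qed
  moreover have "(order_cdf (Suc p) (insert j I) a has_real_derivative ?R) (at x)"
    unfolding eq q_def
    by (rule derivative_eq_intros insert.IH[of p] dp refl | simp add: algebra_simps)+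
  ultimately show ?case by simp
qed

lemma order_cdf_pos:
  assumes "finite I" "\<And>i. i \<in> I \<Longrightarrow> 0 < a i" "0 < x" "p \<le> card I"
  shows "0 < order_cdf p I a x"
proof -
  have "0 < (\<Prod>i\<in>I. 1 - exp (- (a i * x))) * (\<Prod>i\<in>I - I. exp (- (a i * x)))"
    using assms by (simp add: prod_pos)
  also have "\<dots> \<le> order_cdf p I a x"
    unfolding order_cdf_def using assms
    by (intro member_le_sum mult_nonneg_nonneg prod_nonneg) (auto dest!: subsetD simp: less_imp_le)
  finally show ?thesis .
qed

lemma order_cdf_diff:
  assumes "finite I"
  shows "order_cdf p I a x - order_cdf (Suc p) I a x = (\<Sum>S | S \<subseteq> I \<and> card S = p.
     (\<Prod>i\<in>S. 1 - exp (- (a i * x))) * (\<Prod>i\<in>I - S. exp (- (a i * x))))"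
proof -
  have "{S. S \<subseteq> I \<and> p \<le> card S} = {S. S \<subseteq> I \<and> Suc p \<le> card S} \<union> {S. S \<subseteq> I \<and> card S = p}" by auto
  then show ?thesis
    unfolding order_cdf_def using assms by (simp add: sum.union_disjoint disjoint_iff)
qed

lemma order_cdf_less_1:
  assumes "finite I" "\<And>i. i \<in> I \<Longrightarrow> 0 < a i" "0 \<le> x"
  shows "order_cdf (Suc p) I a x < 1"
proof -
  have "order_cdf (Suc p) I a x \<le> order_cdf (Suc 0) I a x"
    unfolding order_cdf_def
  proof (rule sum_mono2)
    fix S assume "S \<in> {S. S \<subseteq> I \<and> Suc 0 \<le> card S} - {S. S \<subseteq> I \<and> Suc p \<le> card S}"
    then show "0 \<le> (\<Prod>i\<in>S. 1 - exp (- (a i * x))) * (\<Prod>i\<in>I - S. exp (- (a i * x)))"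
      using assms by (intro mult_nonneg_nonneg prod_nonneg) (auto dest!: subsetD simp: less_imp_le)
  qed (use assms in auto)
  then show ?thesis using assms(1) by (simp add: order_cdf_Suc_0 order_le_less_trans)
qed

text \<open>
Near \<open>0\<close> exactly \<open>p\<close> of the variables are small, each with probability about \<open>a i * x\<close>; larger
index sets contribute higher powers of \<open>x\<close>.
\<close>

lemma order_cdf_asymptotics:
  assumes "finite I"
  shows "((\<lambda>x. order_cdf p I a x / x ^ p) \<longlongrightarrow> elem_sym p I a) (at_right 0)"
proof -
  define T where "T S x = (\<Prod>i\<in>S. 1 - exp (- (a i * x))) * (\<Prod>i\<in>I - S. exp (- (a i * x)))" for S x
  have lim1: "((\<lambda>x. (1 - exp (- (b * x))) / x) \<longlongrightarrow> b) (at_right 0)" for b :: real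
  proof -
    have "((\<lambda>x. 1 - exp (- (b * x))) has_real_derivative b) (at 0)"
      by (auto intro!: derivative_eq_intros)
    then show ?thesis
      by (simp add: has_field_derivative_iff filterlim_at_split)
  qed
  have T: "((\<lambda>x. T S x / x ^ p) \<longlongrightarrow> (if card S = p then \<Prod>i\<in>S. a i else 0)) (at_right 0)"
    if S: "S \<subseteq> I" "p \<le> card S" for S
  proof -
    have "((\<lambda>x. (\<Prod>i\<in>S. (1 - exp (- (a i * x))) / x) * (\<Prod>i\<in>I - S. exp (- (a i * x))) * x ^ (card S - p))
       \<longlongrightarrow> (\<Prod>i\<in>S. a i) * (\<Prod>i\<in>I - S. exp (- (a i * 0))) * 0 ^ (card S - p)) (at_right 0)"
      by (intro tendsto_intros lim1)
    moreover have "(\<Prod>i\<in>S. a i) * (\<Prod>i\<in>I - S. exp (- (a i * 0))) * 0 ^ (card S - p)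
       = (if card S = p then \<Prod>i\<in>S. a i else 0)"
      using S by (auto simp: power_0_left)
    moreover have "eventually (\<lambda>x. (\<Prod>i\<in>S. (1 - exp (- (a i * x))) / x) * (\<Prod>i\<in>I - S. exp (- (a i * x))) * x ^ (card S - p)
        = T S x / x ^ p) (at_right 0)"
      using eventually_at_right_less[of 0]
    proof eventually_elim
      case (elim x)
      have "x ^ card S = x ^ (card S - p) * x ^ p" using S by (simp add: power_add[symmetric])
      then show ?case using elim by (simp add: T_def prod_dividef field_simps)
    qed
    ultimately show ?thesis by (simp add: tendsto_cong)
  qed
  have "((\<lambda>x. \<Sum>S | S \<subseteq> I \<and> p \<le> card S. T S x / x ^ p) \<longlongrightarrow>
      (\<Sum>S | S \<subseteq> I \<and> p \<le> card S. (if card S = p then \<Prod>i\<in>S. a i else 0))) (at_right 0)"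
    by (intro tendsto_sum T) auto
  moreover have "(\<Sum>S | S \<subseteq> I \<and> p \<le> card S. (if card S = p then \<Prod>i\<in>S. a i else 0)) = elem_sym p I a"
    unfolding elem_sym_def using assms by (intro sum.mono_neutral_cong_right) auto
  ultimately show ?thesis by (simp add: order_cdf_def T_def sum_divide_distrib)
qed

lemma continuous_on_order_cdf: "finite I \<Longrightarrow> continuous_on A (order_cdf p I a)"
  unfolding order_cdf_def by (intro continuous_intros)

lemma order_cdf_tendsto_1:
  assumes "finite I" "p \<le> card I" "\<And>i. i \<in> I \<Longrightarrow> 0 < a i"
  shows "(order_cdf p I a \<longlongrightarrow> 1) at_top"
proof -
  have 0: "((\<lambda>x. exp (- (a i * x))) \<longlongrightarrow> 0) at_top" if "i \<in> I" for i
    using assms(3)[OF that] by real_asymp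
  have "((\<lambda>x. (\<Prod>i\<in>S. 1 - exp (- (a i * x))) * (\<Prod>i\<in>I - S. exp (- (a i * x))))
      \<longlongrightarrow> (if S = I then 1 else 0)) at_top" if "S \<subseteq> I" for S
  proof -
    have "((\<lambda>x. (\<Prod>i\<in>S. 1 - exp (- (a i * x))) * (\<Prod>i\<in>I - S. exp (- (a i * x))))
      \<longlongrightarrow> (\<Prod>i\<in>S. 1 - 0) * (\<Prod>i\<in>I - S. 0)) at_top"
      using that by (intro tendsto_intros 0) auto
    moreover have "(\<Prod>i\<in>S. 1 - 0) * (\<Prod>i\<in>I - S. 0) = (if S = I then 1 else (0::real))"
    proof (cases "S = I")
      case False
      then have "I - S \<noteq> {}" using that by auto
      then show ?thesis using False assms(1) by (simp add: card_gt_0_iff power_0_left)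
    qed auto
    ultimately show ?thesis by simp
  qed
  then have "((\<lambda>x. order_cdf p I a x) \<longlongrightarrow> (\<Sum>S | S \<subseteq> I \<and> p \<le> card S. if S = I then 1 else 0)) at_top"
    unfolding order_cdf_def by (intro tendsto_sum) auto
  then show ?thesis using assms by (simp add: sum.delta)
qed

lemma order_cdf_strict_mono:
  assumes "finite I" "\<And>i. i \<in> I \<Longrightarrow> 0 < a i" "p < card I" "0 \<le> x" "x < y"
  shows "order_cdf (Suc p) I a x < order_cdf (Suc p) I a y"
proof (rule DERIV_pos_imp_increasing_open[OF \<open>x < y\<close>])
  show "continuous_on {x..y} (order_cdf (Suc p) I a)" by (rule continuous_on_order_cdf[OF assms(1)])
next
  fix z assume "x < z" "z < y"
  then have "0 < z" using assms by simp
  have pos: "0 < a i * (order_cdf p (I - {i}) a z - order_cdf (Suc p) I a z)" if i: "i \<in> I" for i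
  proof -
    have "I = insert i (I - {i})" using i by auto
    then have "order_cdf (Suc p) I a z = exp (- (a i * z)) * order_cdf (Suc p) (I - {i}) a z
        + (1 - exp (- (a i * z))) * order_cdf p (I - {i}) a z"
      using order_cdf_insert[of "I - {i}" i p a z] assms(1) by auto
    then have eq: "order_cdf p (I - {i}) a z - order_cdf (Suc p) I a z =
        exp (- (a i * z)) * (order_cdf p (I - {i}) a z - order_cdf (Suc p) (I - {i}) a z)"
      by (simp add: algebra_simps)
    have "p \<le> card (I - {i})" using assms(1,3) i by simp
    then obtain S where "S \<subseteq> I - {i}" "card S = p" using obtain_subset_with_card_n by metis
    then have ne: "{S. S \<subseteq> I - {i} \<and> card S = p} \<noteq> {}" by auto
    have "0 < order_cdf p (I - {i}) a z - order_cdf (Suc p) (I - {i}) a z"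
      unfolding order_cdf_diff[OF finite_Diff[OF assms(1)]]
    proof (rule sum_pos)
      show "finite {S. S \<subseteq> I - {i} \<and> card S = p}" 
        by (rule finite_subset[of _ "Pow I"]) (use assms(1) in auto)
      fix S assume "S \<in> {S. S \<subseteq> I - {i} \<and> card S = p}"
      then have "\<And>j. j \<in> S \<Longrightarrow> 0 < a j * z" using assms(2) \<open>0 < z\<close> by auto
      then show "0 < (\<Prod>i\<in>S. 1 - exp (- (a i * z))) * (\<Prod>i\<in>I - {i} - S. exp (- (a i * z)))"
        by (intro mult_pos_pos prod_pos) auto
    qed (fact ne)
    then show ?thesis unfolding eq using assms(2)[OF i] by simp
  qed
  have "I \<noteq> {}" using assms(3) by auto
  then have "0 < (\<Sum>i\<in>I. a i * (order_cdf p (I - {i}) a z - order_cdf (Suc p) I a z))"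
    using pos assms(1) by (intro sum_pos)
  then show "\<exists>d. (order_cdf (Suc p) I a has_real_derivative d) (at z) \<and> 0 < d"
    using order_cdf_has_derivative[OF assms(1), of p a z] by blast
qed

section \<open>Homogeneous samples\<close>

definition hom_cdf :: "nat \<Rightarrow> nat \<Rightarrow> real \<Rightarrow> real" where
  "hom_cdf p N = order_cdf p {..<N} (\<lambda>_. 1)"

lemma order_cdf_homogeneous:
  assumes "finite I"
  shows "order_cdf p I (\<lambda>_. c) x = hom_cdf p (card I) (c * x)"
  using assms
proof (induction I arbitrary: p rule: finite_induct)
  case empty
  then show ?case by (cases p) (auto simp: hom_cdf_def order_cdf_empty order_cdf_0)
next
  case (insert j I)
  show ?case
  proof (cases p)
    case 0
    then show ?thesis using insert by (simp add: hom_cdf_def order_cdf_0)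
  next
    case (Suc p')
    have "hom_cdf (Suc p') (card (insert j I)) (c * x) =
       order_cdf (Suc p') (insert (card I) {..<card I}) (\<lambda>_. 1) (c * x)"
      using insert by (simp add: hom_cdf_def lessThan_Suc)
    then show ?thesis
      using insert Suc by (simp add: order_cdf_insert hom_cdf_def)
  qed
qed

text \<open>
The density of the order statistic of rank \<open>p + 1\<close> among \<open>N + 1\<close> unit exponentials. The shift
keeps rank and sample size positive.
\<close>

definition hom_pdf :: "nat \<Rightarrow> nat \<Rightarrow> real \<Rightarrow> real" where
  "hom_pdf p N t = real (Suc N) * real (N choose p) * ((1 - exp (- t)) ^ p * exp (- t) ^ (Suc N - p))"

lemma hom_cdf_diff:
  assumes "p \<le> N"
  shows "real (Suc N) * (hom_cdf p N t - hom_cdf (Suc p) (Suc N) t) = hom_pdf p N t"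
proof -
  have card: "card {S. S \<subseteq> {..<N} \<and> card S = p} = N choose p"
    using n_subsets[of "{..<N}" p] by simp
  have "hom_cdf (Suc p) (Suc N) t = exp (- t) * hom_cdf (Suc p) N t + (1 - exp (- t)) * hom_cdf p N t"
    by (simp add: hom_cdf_def lessThan_Suc order_cdf_insert)
  then have "hom_cdf p N t - hom_cdf (Suc p) (Suc N) t = exp (- t) * (hom_cdf p N t - hom_cdf (Suc p) N t)"
    by (simp add: algebra_simps)
  also have "hom_cdf p N t - hom_cdf (Suc p) N t =
      (\<Sum>S | S \<subseteq> {..<N} \<and> card S = p. (1 - exp (- t)) ^ p * exp (- t) ^ (N - p))"
    unfolding hom_cdf_def order_cdf_diff[OF finite_lessThan]
  proof (intro sum.cong refl)
    fix S assume "S \<in> {S. S \<subseteq> {..<N} \<and> card S = p}"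
    then show "(\<Prod>i\<in>S. 1 - exp (- (1 * t))) * (\<Prod>i\<in>{..<N} - S. exp (- (1 * t)))
        = (1 - exp (- t)) ^ p * exp (- t) ^ (N - p)"
      by (simp add: card_Diff_subset finite_subset[of S "{..<N}"])
  qed
  also have "\<dots> = real (N choose p) * ((1 - exp (- t)) ^ p * exp (- t) ^ (N - p))"
    using card by simp
  finally show ?thesis using assms by (simp add: hom_pdf_def Suc_diff_le)
qed

lemma hom_cdf_has_derivative:
  assumes "p \<le> N"
  shows "(hom_cdf (Suc p) (Suc N) has_real_derivative hom_pdf p N t) (at t)"
proof -
  have "order_cdf p ({..<Suc N} - {i}) (\<lambda>_. 1) t = hom_cdf p N t" if "i \<in> {..<Suc N}" for i
    using that by (subst order_cdf_homogeneous) auto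
  then have "(\<Sum>i<Suc N. 1 * (order_cdf p ({..<Suc N} - {i}) (\<lambda>_. 1) t - order_cdf (Suc p) {..<Suc N} (\<lambda>_. 1) t))
      = hom_pdf p N t"
    using hom_cdf_diff[OF assms, of t] by (simp add: hom_cdf_def del: sum.lessThan_Suc)
  then show ?thesis
    using order_cdf_has_derivative[of "{..<Suc N}" p "\<lambda>_. 1" t] unfolding hom_cdf_def by simp
qed

lemma hom_pdf_pos: "0 < t \<Longrightarrow> p \<le> N \<Longrightarrow> 0 < hom_pdf p N t"
  unfolding hom_pdf_def by (intro mult_pos_pos) auto

lemma hom_cdf_strict_mono:
  assumes "p \<le> N" "0 \<le> s" "s < t"
  shows "hom_cdf (Suc p) (Suc N) s < hom_cdf (Suc p) (Suc N) t"
proof (rule DERIV_pos_imp_increasing_open[OF assms(3)])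
  show "continuous_on {s..t} (hom_cdf (Suc p) (Suc N))"
    using hom_cdf_has_derivative[OF assms(1)]
    by (meson DERIV_isCont continuous_at_imp_continuous_on)
qed (use assms hom_cdf_has_derivative hom_pdf_pos in force)

lemma hom_cdf_le_iff:
  assumes "p \<le> N" "0 \<le> s" "0 \<le> t"
  shows "hom_cdf (Suc p) (Suc N) s \<le> hom_cdf (Suc p) (Suc N) t \<longleftrightarrow> s \<le> t"
  using hom_cdf_strict_mono[OF assms(1,2), of t] hom_cdf_strict_mono[OF assms(1,3), of s]
  by (cases s t rule: linorder_cases) auto

lemma hom_cdf_at_0: "hom_cdf (Suc p) N 0 = 0"
  by (simp add: hom_cdf_def order_cdf_at_0)

lemma hom_cdf_less_1: "0 \<le> t \<Longrightarrow> hom_cdf (Suc p) N t < 1"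
  by (simp add: hom_cdf_def order_cdf_less_1)

lemma hom_cdf_attains:
  assumes "p \<le> N" "0 < u" "u < 1"
  obtains t where "0 < t" "hom_cdf (Suc p) (Suc N) t = u"
proof -
  let ?G = "hom_cdf (Suc p) (Suc N)"
  have "(?G \<longlongrightarrow> 1) at_top"
    unfolding hom_cdf_def using assms by (intro order_cdf_tendsto_1) auto
  then have "eventually (\<lambda>t. u < ?G t \<and> 0 < t) at_top"
    using assms by (intro eventually_conj order_tendstoD eventually_gt_at_top) auto
  then obtain t where t: "u < ?G t" "0 < t" by (auto simp: eventually_at_top_linorder)
  have "\<exists>s. 0 \<le> s \<and> s \<le> t \<and> ?G s = u"
  proof (rule IVT')
    show "continuous_on {0..t} ?G" unfolding hom_cdf_def by (rule continuous_on_order_cdf) simp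
  qed (use t assms in \<open>auto simp: hom_cdf_at_0\<close>)
  then obtain s where "0 \<le> s" "?G s = u" by auto
  then show ?thesis using that[of s] assms hom_cdf_at_0[of p "Suc N"] by (cases "s = 0") auto
qed

text \<open>
The limit case \<open>u \<rightarrow> 0\<close> of the lemma below: a concave function that vanishes at \<open>0\<close> has decreasing
slopes seen from \<open>0\<close>.
\<close>

lemma one_minus_exp_quotient_antimono:
  fixes x y :: real
  assumes "0 < x" "x \<le> y"
  shows "x * (1 - exp (- y)) \<le> y * (1 - exp (- x))"
proof -
  have "exp ((1 - x / y) *\<^sub>R 0 + (x / y) *\<^sub>R (- y)) \<le> (1 - x / y) * exp 0 + (x / y) * exp (- y)"
    using assms by (intro convex_onD[OF exp_convex]) auto
  then have "exp (- x) \<le> 1 - x / y * (1 - exp (- y))" using assms by (simp add: algebra_simps)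
  then have "x / y * (1 - exp (- y)) \<le> 1 - exp (- x)" by simp
  then show ?thesis using assms by (simp add: field_simps)
qed

text \<open>
The quotient \<open>(1 - exp (- (u * x))) / (1 - exp (- x))\<close> increases in \<open>x\<close>: the sign of its derivative
is that of \<open>u * (exp x - 1) - (exp (u * x) - 1)\<close>, which convexity of the exponential function
makes nonnegative.
\<close>

lemma exp_dilation_ratio:
  fixes x y u :: real
  assumes "0 < x" "x \<le> y" "0 < u" "u \<le> 1"
  shows "(1 - exp (- (u * x))) * (1 - exp (- y)) \<le> (1 - exp (- (u * y))) * (1 - exp (- x))"
proof -
  define f where "f z = (1 - exp (- (u * z))) / (1 - exp (- z))" for z
  have "f x \<le> f y"
  proof (rule DERIV_nonneg_imp_nondecreasing[OF assms(2)])
    fix z assume z: "x \<le> z" "z \<le> y"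
    then have "0 < z" using assms by simp
    have "exp ((1 - u) *\<^sub>R 0 + u *\<^sub>R z) \<le> (1 - u) * exp 0 + u * exp z"
      using assms by (intro convex_onD[OF exp_convex]) auto
    then have "exp (- (u * z)) * exp (- z) * (exp (u * z) - 1) \<le> exp (- (u * z)) * exp (- z) * (u * (exp z - 1))"
      by (intro mult_left_mono) (auto simp: algebra_simps)
    moreover have "exp (- (u * z)) * exp (- z) * (exp (u * z) - 1) = (1 - exp (- (u * z))) * exp (- z)"
      "exp (- (u * z)) * exp (- z) * (u * (exp z - 1)) = u * exp (- (u * z)) * (1 - exp (- z))"
      by (simp_all add: right_diff_distrib left_diff_distrib exp_minus field_simps)
    ultimately have ge: "0 \<le> u * exp (- (u * z)) * (1 - exp (- z)) - (1 - exp (- (u * z))) * exp (- z)"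
      by simp
    have "(f has_real_derivative (u * exp (- (u * z)) * (1 - exp (- z)) - (1 - exp (- (u * z))) * exp (- z)) /
        ((1 - exp (- z)) * (1 - exp (- z)))) (at z)"
      unfolding f_def using \<open>0 < z\<close> by (auto intro!: derivative_eq_intros)
    then show "\<exists>y. (f has_real_derivative y) (at z) \<and> 0 \<le> y"
      using ge by (intro exI conjI) (auto intro: divide_nonneg_nonneg)
  qed
  then show ?thesis using assms by (simp add: f_def divide_simps mult_ac)
qed

text \<open>
This says that \<open>hom_pdf p N (\<rho> * t) / hom_pdf p N t\<close> decreases in \<open>t\<close>. The factor
\<open>exp (- (\<rho> - 1) * t)\<close> of this quotient clearly does; the other factor is the content of
\<open>exp_dilation_ratio\<close>.
\<close>

lemma hom_pdf_dilation:
  assumes "p \<le> N" "1 \<le> \<rho>" "0 \<le> s" "s \<le> t"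
  shows "hom_pdf p N (\<rho> * t) * hom_pdf p N s \<le> hom_pdf p N (\<rho> * s) * hom_pdf p N t"
proof -
  define b where "b = Suc N - p"
  have *: "0 \<le> 1 - exp (- v)" if "0 \<le> v" for v :: real using that by simp
  have "(1 - exp (- (\<rho> * t))) * (1 - exp (- s)) \<le> (1 - exp (- (\<rho> * s))) * (1 - exp (- t))"
    using exp_dilation_ratio[of "\<rho> * s" "\<rho> * t" "1 / \<rho>"] assms
    by (cases "s = 0") (simp_all add: mult_ac)
  then have 1: "((1 - exp (- (\<rho> * t))) * (1 - exp (- s))) ^ p \<le> ((1 - exp (- (\<rho> * s))) * (1 - exp (- t))) ^ p"
    using assms by (intro power_mono mult_nonneg_nonneg *) auto
  have "(\<rho> - 1) * s \<le> (\<rho> - 1) * t" using assms by (intro mult_left_mono) auto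
  then have "exp (- (\<rho> * t)) * exp (- s) \<le> exp (- (\<rho> * s)) * exp (- t)"
    by (simp add: exp_add[symmetric] algebra_simps)
  then have 2: "(exp (- (\<rho> * t)) * exp (- s)) ^ b \<le> (exp (- (\<rho> * s)) * exp (- t)) ^ b"
    by (intro power_mono) auto
  have "((1 - exp (- (\<rho> * t))) * (1 - exp (- s))) ^ p * (exp (- (\<rho> * t)) * exp (- s)) ^ b
      \<le> ((1 - exp (- (\<rho> * s))) * (1 - exp (- t))) ^ p * (exp (- (\<rho> * s)) * exp (- t)) ^ b"
    using assms by (intro mult_mono 1 2 zero_le_power mult_nonneg_nonneg *) auto
  then have "(real (Suc N) * real (N choose p))\<^sup>2 * (((1 - exp (- (\<rho> * t))) * (1 - exp (- s))) ^ p * (exp (- (\<rho> * t)) * exp (- s)) ^ b)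
      \<le> (real (Suc N) * real (N choose p))\<^sup>2 * (((1 - exp (- (\<rho> * s))) * (1 - exp (- t))) ^ p * (exp (- (\<rho> * s)) * exp (- t)) ^ b)"
    by (intro mult_left_mono) auto
  then show ?thesis
    unfolding hom_pdf_def b_def by (simp add: power_mult_distrib power2_eq_square mult_ac)
qed

text \<open>
With \<open>G\<close> for the distribution function, \<open>K u = G (\<rho> * G\<^sup>-\<^sup>1 u)\<close> is a concave function of \<open>u\<close>, and the
inequality is that of its tangent at \<open>u = G s\<close>, with slope \<open>\<kappa>\<close>. Writing it in terms of \<open>t\<close> avoids the inverse
function. Concavity holds because the derivative of \<open>K\<close> at \<open>G t\<close> is \<open>\<rho> * g (\<rho> * t) / g t\<close>, which
decreases in \<open>t\<close>.
\<close>

lemma hom_cdf_tangent: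
  assumes "p \<le> N" "1 \<le> \<rho>" "0 < s"
  obtains \<kappa> where "0 \<le> \<kappa>"
    "\<And>t. 0 \<le> t \<Longrightarrow> hom_cdf (Suc p) (Suc N) (\<rho> * t) - hom_cdf (Suc p) (Suc N) (\<rho> * s)
        \<le> \<kappa> * (hom_cdf (Suc p) (Suc N) t - hom_cdf (Suc p) (Suc N) s)"
proof -
  let ?G = "hom_cdf (Suc p) (Suc N)" and ?g = "hom_pdf p N"
  \<comment> \<open>the function \<open>\<psi>\<close> below increases up to \<open>s\<close> and decreases afterwards\<close>
  define \<kappa> where "\<kappa> = \<rho> * ?g (\<rho> * s) / ?g s"
  have gs: "0 < ?g s" "0 < ?g (\<rho> * s)" using assms by (auto intro!: hom_pdf_pos mult_pos_pos)
  define \<psi> where "\<psi> t = ?G (\<rho> * t) - \<kappa> * ?G t" for t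
  have d: "(\<psi> has_real_derivative (\<rho> * ?g (\<rho> * t) - \<kappa> * ?g t)) (at t)" for t
    unfolding \<psi>_def
    by (rule derivative_eq_intros DERIV_chain2[OF hom_cdf_has_derivative[OF assms(1)]]
        hom_cdf_has_derivative[OF assms(1)] refl | simp)+
  have sgn: "\<rho> * ?g (\<rho> * t) - \<kappa> * ?g t = \<rho> / ?g s * (?g (\<rho> * t) * ?g s - ?g (\<rho> * s) * ?g t)" for t
    using gs by (simp add: \<kappa>_def field_simps)
  have max: "\<psi> t \<le> \<psi> s" if "0 \<le> t" for t
  proof (cases "t \<le> s")
    case True
    show ?thesis
    proof (rule DERIV_nonneg_imp_nondecreasing[OF True])
      fix z assume "t \<le> z" "z \<le> s"
      then have "0 \<le> \<rho> / ?g s * (?g (\<rho> * z) * ?g s - ?g (\<rho> * s) * ?g z)"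
        using hom_pdf_dilation[of p N \<rho> z s] assms that gs by (intro mult_nonneg_nonneg) auto
      then show "\<exists>y. (\<psi> has_real_derivative y) (at z) \<and> 0 \<le> y" using d[of z] sgn[of z] by auto
    qed
  next
    case False
    then have "s \<le> t" by simp
    then show ?thesis
    proof (rule DERIV_nonpos_imp_nonincreasing)
      fix z assume "s \<le> z" "z \<le> t"
      then have "\<rho> / ?g s * (?g (\<rho> * z) * ?g s - ?g (\<rho> * s) * ?g z) \<le> 0"
        using hom_pdf_dilation[of p N \<rho> s z] assms gs by (intro mult_nonneg_nonpos) auto
      then show "\<exists>y. (\<psi> has_real_derivative y) (at z) \<and> y \<le> 0" using d[of z] sgn[of z] by auto
    qed
  qed
  show ?thesis
  proof (rule that[of \<kappa>])
    show "0 \<le> \<kappa>" using gs assms by (simp add: \<kappa>_def)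
    show "?G (\<rho> * t) - ?G (\<rho> * s) \<le> \<kappa> * (?G t - ?G s)" if "0 \<le> t" for t
      using max[OF that] by (simp add: \<psi>_def algebra_simps)
  qed
qed

section \<open>Elementary symmetric functions and Maclaurin's inequality\<close>

lemma elem_sym_insert:
  assumes "finite I" "j \<notin> I"
  shows "elem_sym (Suc p) (insert j I) a = elem_sym (Suc p) I a + a j * elem_sym p I a"
proof -
  have 0: "card (insert j S) = Suc (card S)" if "S \<subseteq> I" for S
    using assms that by (subst card_insert_disjoint) (auto intro: finite_subset)
  have 1: "(\<Prod>i\<in>insert j S. a i) = a j * (\<Prod>i\<in>S. a i)" if "S \<subseteq> I" for S
    using assms that by (subst prod.insert) (auto intro: finite_subset)
  show ?thesis
    unfolding elem_sym_def sum_subsets_insert[OF assms, where P = "\<lambda>S. card S = Suc p"]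
    by (simp add: sum_distrib_left) (auto simp: 0 1 intro!: arg_cong2[where f = "(+)"] sum.cong)
qed

lemma elem_sym_0: "finite I \<Longrightarrow> elem_sym 0 I a = 1"
proof -
  assume "finite I"
  then have "{S. S \<subseteq> I \<and> card S = 0} = {{}}" by (auto dest: finite_subset)
  then show ?thesis by (simp add: elem_sym_def)
qed

lemma elem_sym_empty: "elem_sym (Suc p) {} a = 0"
  by (auto simp: elem_sym_def)

lemma elem_sym_nonneg: "(\<And>i. i \<in> I \<Longrightarrow> 0 < a i) \<Longrightarrow> 0 \<le> elem_sym p I a"
  unfolding elem_sym_def by (intro sum_nonneg prod_nonneg) (auto simp: less_imp_le subset_iff)

lemma elem_sym_const:
  assumes "finite I"
  shows "elem_sym p I (\<lambda>_. c) = real (card I choose p) * c ^ p"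
  using n_subsets[OF assms, of p] by (simp add: elem_sym_def)

text \<open>
Each \<open>p\<close>-element subset of \<open>I\<close> survives the removal of the \<open>card I - p\<close> indices outside it.
\<close>

lemma sum_elem_sym_remove:
  assumes "finite I"
  shows "(\<Sum>r\<in>I. elem_sym p (I - {r}) a) = (real (card I) - real p) * elem_sym p I a"
  using assms
proof (induction I arbitrary: p rule: finite_induct)
  case empty
  then show ?case by (cases p) (auto simp: elem_sym_empty)
next
  case (insert j I)
  show ?case
  proof (cases p)
    case 0
    then show ?thesis using insert by (simp add: elem_sym_0)
  next
    case (Suc p')
    have *: "elem_sym p (insert j I - {r}) a = elem_sym p (I - {r}) a + a j * elem_sym p' (I - {r}) a"
      if "r \<in> I" for r
    proof -
      have "insert j I - {r} = insert j (I - {r})" using insert that by auto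
      then show ?thesis using insert Suc by (simp add: elem_sym_insert)
    qed
    have "insert j I - {j} = I" using insert by auto
    then have "(\<Sum>r\<in>insert j I. elem_sym p (insert j I - {r}) a) =
       elem_sym p I a + ((\<Sum>r\<in>I. elem_sym p (I - {r}) a) + a j * (\<Sum>r\<in>I. elem_sym p' (I - {r}) a))"
      using insert.hyps by (simp add: * sum.distrib sum_distrib_left)
    then show ?thesis
      using insert Suc by (simp add: elem_sym_insert algebra_simps)
  qed
qed

text \<open>
Each \<open>(p + 1)\<close>-element subset arises once for every choice of its member \<open>r\<close>.
\<close>

lemma sum_mult_elem_sym_remove:
  assumes "finite I"
  shows "(\<Sum>r\<in>I. a r * elem_sym p (I - {r}) a) = real (Suc p) * elem_sym (Suc p) I a"
  using assms
proof (induction I arbitrary: p rule: finite_induct)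
  case empty
  then show ?case by (auto simp: elem_sym_empty)
next
  case (insert j I)
  have j: "insert j I - {j} = I" using insert by auto
  have r: "insert j I - {r} = insert j (I - {r})" if "r \<in> I" for r using insert that by auto
  show ?case
  proof (cases p)
    case 0
    then show ?thesis using insert.hyps insert.IH[of 0] by (simp add: elem_sym_0 elem_sym_insert algebra_simps)
  next
    case (Suc p')
    have *: "a r * elem_sym p (insert j I - {r}) a = a r * elem_sym p (I - {r}) a + a j * (a r * elem_sym p' (I - {r}) a)"
      if "r \<in> I" for r
      using insert Suc that by (simp add: r elem_sym_insert algebra_simps)
    have "(\<Sum>r\<in>insert j I. a r * elem_sym p (insert j I - {r}) a) =
       a j * elem_sym p I a + ((\<Sum>r\<in>I. a r * elem_sym p (I - {r}) a) + a j * (\<Sum>r\<in>I. a r * elem_sym p' (I - {r}) a))"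
      using insert.hyps by (simp add: * j sum.distrib sum_distrib_left)
    then show ?thesis
      using insert Suc by (simp add: elem_sym_insert algebra_simps)
  qed
qed

text \<open>
Chebyshev's sum inequality for two families on an unordered index set, which only need to be
oppositely ordered pair by pair.
\<close>

lemma sum_mult_le_opposite_order:
  fixes a b :: "'i \<Rightarrow> real"
  assumes "finite I" "\<And>r t. r \<in> I \<Longrightarrow> t \<in> I \<Longrightarrow> (a r - a t) * (b r - b t) \<le> 0"
  shows "real (card I) * (\<Sum>r\<in>I. a r * b r) \<le> (\<Sum>r\<in>I. a r) * (\<Sum>r\<in>I. b r)"
proof -
  have "(\<Sum>r\<in>I. \<Sum>t\<in>I. (a r - a t) * (b r - b t)) \<le> 0"
    using assms by (intro sum_nonpos) auto
  also have "(\<Sum>r\<in>I. \<Sum>t\<in>I. (a r - a t) * (b r - b t)) =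
     (\<Sum>r\<in>I. \<Sum>t\<in>I. a r * b r) - (\<Sum>r\<in>I. \<Sum>t\<in>I. a r * b t) - (\<Sum>r\<in>I. \<Sum>t\<in>I. a t * b r) + (\<Sum>r\<in>I. \<Sum>t\<in>I. a t * b t)"
    by (simp add: algebra_simps sum.distrib sum_subtractf)
  also have "(\<Sum>r\<in>I. \<Sum>t\<in>I. a t * b r) = (\<Sum>r\<in>I. \<Sum>t\<in>I. a r * b t)" by (rule sum.swap)
  also have "(\<Sum>r\<in>I. \<Sum>t\<in>I. a r * b t) = (\<Sum>r\<in>I. a r) * (\<Sum>r\<in>I. b r)" by (simp add: sum_product)
  also have "(\<Sum>r\<in>I. \<Sum>t\<in>I. a r * b r) = real (card I) * (\<Sum>r\<in>I. a r * b r)" by (simp add: sum_distrib_left)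
  finally show ?thesis by simp
qed

text \<open>
Removing a larger entry leaves a smaller elementary symmetric function.
\<close>

lemma elem_sym_remove_antimono:
  assumes "finite I" "\<And>i. i \<in> I \<Longrightarrow> 0 < a i" "r \<in> I" "t \<in> I"
  shows "(a r - a t) * (elem_sym p (I - {r}) a - elem_sym p (I - {t}) a) \<le> 0"
proof (cases "r = t \<or> p = 0")
  case True
  then show ?thesis using assms(1) by (auto simp: elem_sym_0)
next
  case False
  then obtain p' where p: "p = Suc p'" and "r \<noteq> t" by (cases p) auto
  define K where "K = I - {r, t}"
  have K: "I - {r} = insert t K" "I - {t} = insert r K" "finite K" "r \<notin> K" "t \<notin> K"
    using assms \<open>r \<noteq> t\<close> by (auto simp: K_def)
  have "(a r - a t) * (elem_sym p (I - {r}) a - elem_sym p (I - {t}) a) = - ((a r - a t)\<^sup>2 * elem_sym p' K a)"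
    unfolding K(1,2) p using K(3-5) by (simp add: elem_sym_insert power2_eq_square algebra_simps)
  moreover have "0 \<le> elem_sym p' K a" using assms by (intro elem_sym_nonneg) (auto simp: K_def)
  ultimately show ?thesis by simp
qed

text \<open>
Chebyshev's inequality, applied to \<open>a r\<close> and to the symmetric function without \<open>a r\<close>, gives
\<open>n * (p + 1) * e\<^sub>p\<^sub>+\<^sub>1 \<le> L * (n - p) * e\<^sub>p\<close>, from which the claim follows by induction on \<open>p\<close>.
\<close>

lemma maclaurin_inequality:
  assumes "finite I" "\<And>i. i \<in> I \<Longrightarrow> 0 < a i" "p \<le> card I"
  shows "elem_sym p I a \<le> real (card I choose p) * ((\<Sum>i\<in>I. a i) / real (card I)) ^ p"
  using assms(3)
proof (induction p)
  case 0
  then show ?case using assms(1) by (simp add: elem_sym_0)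
next
  case (Suc p)
  define n where "n = card I"
  define L where "L = (\<Sum>i\<in>I. a i)"
  have "0 < n" "p < n" using Suc by (auto simp: n_def)
  have "0 \<le> L" unfolding L_def using assms by (intro sum_nonneg) (auto simp: less_imp_le)
  have "real n * (real (Suc p) * elem_sym (Suc p) I a) \<le> L * ((real n - real p) * elem_sym p I a)"
    unfolding n_def L_def sum_mult_elem_sym_remove[OF assms(1), symmetric] sum_elem_sym_remove[OF assms(1), symmetric]
    by (intro sum_mult_le_opposite_order elem_sym_remove_antimono assms)
  also have "\<dots> \<le> L * ((real n - real p) * (real (n choose p) * (L / real n) ^ p))"
    using Suc \<open>0 \<le> L\<close> by (intro mult_left_mono) (auto simp: n_def L_def)
  also have "L * ((real n - real p) * (real (n choose p) * (L / real n) ^ p))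
      = ((real n - real p) * real (n choose p)) * (L / real n) ^ p * L"
    by (simp only: mult_ac)
  also have "(real n - real p) * real (n choose p) = real (Suc p) * real (n choose Suc p)"
  proof -
    have "Suc p * (n choose Suc p) = (n - p) * (n choose p)"
      by (simp only: binomial_absorb_comp binomial_absorption)
    then have "real (Suc p * (n choose Suc p)) = real ((n - p) * (n choose p))" by simp
    then show ?thesis using \<open>p < n\<close> by (simp only: of_nat_mult of_nat_diff less_imp_le)
  qed
  also have "real (Suc p) * real (n choose Suc p) * (L / real n) ^ p * L
     = real n * (real (Suc p) * (real (n choose Suc p) * (L / real n) ^ Suc p))"
    using \<open>0 < n\<close> by (simp del: of_nat_Suc)
  finally have "real n * (real (Suc p) * elem_sym (Suc p) I a) \<le>
    real n * (real (Suc p) * (real (n choose Suc p) * (L / real n) ^ Suc p))" .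
  then have "elem_sym (Suc p) I a \<le> real (n choose Suc p) * (L / real n) ^ Suc p"
    using \<open>0 < n\<close> by (simp only: mult_le_cancel_left_pos of_nat_0_less_iff zero_less_Suc)
  then show ?case by (simp only: n_def L_def)
qed

section \<open>The star order and mixtures\<close>

text \<open>
For continuous strictly increasing distribution functions on \<open>[0, \<infinity>)\<close>, this is the star order in
the form that \<open>G\<^sup>-\<^sup>1 (F x) / x\<close> decreases: each level \<open>c\<close> is crossed at most once, downwards. Stated by
crossings it needs no inverse functions, and it suits arguments about sign changes.
\<close>

definition star_above :: "(real \<Rightarrow> real) \<Rightarrow> (real \<Rightarrow> real) \<Rightarrow> bool" where
  "star_above F G \<longleftrightarrow> (\<forall>c>0. \<forall>x>0. \<forall>y\<ge>x. F x \<le> G (c * x) \<longrightarrow> F y \<le> G (c * y))"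

lemma star_aboveD: "star_above F G \<Longrightarrow> 0 < c \<Longrightarrow> 0 < x \<Longrightarrow> x \<le> y \<Longrightarrow> F x \<le> G (c * x) \<Longrightarrow> F y \<le> G (c * y)"
  by (simp add: star_above_def)

lemma hom_cdf_scale_attains:
  assumes "p \<le> N" "0 < u" "u < 1" "0 < x"
  shows "\<exists>c>0. hom_cdf (Suc p) (Suc N) (c * x) = u"
proof -
  obtain t where "0 < t" "hom_cdf (Suc p) (Suc N) t = u" using hom_cdf_attains[OF assms(1-3)] .
  then show ?thesis using assms(4) by (intro exI[of _ "t / x"]) simp
qed

text \<open>
If \<open>F j x = G (d j * x)\<close>, then \<open>F j y \<le> G (d j * y)\<close> for \<open>y \<ge> x\<close>, so it suffices to mix the functions
\<open>G (d j * x)\<close>. Passing from \<open>x\<close> to \<open>y\<close> applies the concave function \<open>K\<close> of \<open>hom_cdf_tangent\<close> with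
\<open>\<rho> = y / x\<close> to their values, and the tangent inequality at \<open>G (c * x)\<close> yields Jensen's inequality.
\<close>

lemma star_above_mixture:
  fixes w :: "'j \<Rightarrow> real"
  assumes "finite J" "p \<le> N"
    and w: "\<And>j. j \<in> J \<Longrightarrow> 0 \<le> w j" "(\<Sum>j\<in>J. w j) = 1"
    and star: "\<And>j. j \<in> J \<Longrightarrow> star_above (F j) (hom_cdf (Suc p) (Suc N))"
    and range: "\<And>j x. j \<in> J \<Longrightarrow> 0 < x \<Longrightarrow> 0 < F j x \<and> F j x < 1"
  shows "star_above (\<lambda>x. \<Sum>j\<in>J. w j * F j x) (hom_cdf (Suc p) (Suc N))"
  unfolding star_above_def
proof (intro allI impI)
  let ?G = "hom_cdf (Suc p) (Suc N)"
  fix c x y :: real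
  assume "0 < c" "0 < x" "x \<le> y" and le: "(\<Sum>j\<in>J. w j * F j x) \<le> ?G (c * x)"
  have "\<exists>d>0. ?G (d * x) = F j x" if "j \<in> J" for j
    using hom_cdf_scale_attains[OF assms(2), of "F j x" x] range[OF that] \<open>0 < x\<close> by blast
  then obtain d where d: "\<And>j. j \<in> J \<Longrightarrow> 0 < d j" "\<And>j. j \<in> J \<Longrightarrow> ?G (d j * x) = F j x" by metis
  obtain \<kappa> where k: "0 \<le> \<kappa>"
    "\<And>t. 0 \<le> t \<Longrightarrow> ?G (y / x * t) - ?G (y / x * (c * x)) \<le> \<kappa> * (?G t - ?G (c * x))"
    using hom_cdf_tangent[OF assms(2), of "y / x" "c * x"] \<open>0 < c\<close> \<open>0 < x\<close> \<open>x \<le> y\<close> by auto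
  have "F j y - ?G (c * y) \<le> \<kappa> * (F j x - ?G (c * x))" if "j \<in> J" for j
  proof -
    have "F j y \<le> ?G (d j * y)"
      using star_aboveD[OF star[OF that] d(1)[OF that] \<open>0 < x\<close> \<open>x \<le> y\<close>] d(2)[OF that] by simp
    then show ?thesis
      using k(2)[of "d j * x"] d[OF that] \<open>0 < x\<close> by (simp add: mult_ac)
  qed
  then have "(\<Sum>j\<in>J. w j * (F j y - ?G (c * y))) \<le> (\<Sum>j\<in>J. w j * (\<kappa> * (F j x - ?G (c * x))))"
    using w by (intro sum_mono mult_left_mono) auto
  also have "\<dots> = \<kappa> * ((\<Sum>j\<in>J. w j * F j x) - (\<Sum>j\<in>J. w j) * ?G (c * x))"
    by (simp add: sum_distrib_left sum_distrib_right right_diff_distrib sum_subtractf mult_ac)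
  also have "\<dots> \<le> 0" using le k(1) w by (intro mult_nonneg_nonpos) auto
  finally have "(\<Sum>j\<in>J. w j * F j y) - (\<Sum>j\<in>J. w j) * ?G (c * y) \<le> 0"
    by (simp add: sum_distrib_right right_diff_distrib sum_subtractf)
  then show "(\<Sum>j\<in>J. w j * F j y) \<le> ?G (c * y)" using w by simp
qed

text \<open>
Were \<open>F x = G (d * x)\<close> with \<open>d > c\<close>, the star order would force \<open>G (d * z) \<le> F z\<close> for all smaller \<open>z\<close>.
Comparing the leading coefficients at \<open>0\<close> then contradicts the bound on \<open>s\<close>.
\<close>

lemma star_above_dominated:
  assumes "p \<le> N" and star: "star_above F (hom_cdf (Suc p) (Suc N))"
    and range: "\<And>x. 0 < x \<Longrightarrow> 0 < F x \<and> F x < 1"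
    and lim: "((\<lambda>x. F x / x ^ Suc p) \<longlongrightarrow> s) (at_right 0)"
    and "0 < c" "s \<le> real (Suc N choose Suc p) * c ^ Suc p" "0 < x"
  shows "F x \<le> hom_cdf (Suc p) (Suc N) (c * x)"
proof (rule ccontr)
  let ?G = "hom_cdf (Suc p) (Suc N)"
  assume not: "\<not> ?thesis"
  obtain d where d: "0 < d" "?G (d * x) = F x"
    using hom_cdf_scale_attains[OF assms(1), of "F x" x] range[OF \<open>0 < x\<close>] \<open>0 < x\<close> by blast
  have "c < d"
  proof (rule ccontr)
    assume "\<not> c < d"
    then have "?G (d * x) \<le> ?G (c * x)" using assms d by (subst hom_cdf_le_iff) auto
    with not d show False by simp
  qed
  have ge: "?G (d * z) \<le> F z" if "0 < z" "z < x" for z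
  proof (rule ccontr)
    assume lt: "\<not> ?G (d * z) \<le> F z"
    obtain e where e: "0 < e" "?G (e * z) = F z"
      using hom_cdf_scale_attains[OF assms(1), of "F z" z] range[OF \<open>0 < z\<close>] \<open>0 < z\<close> by blast
    have "e < d"
    proof (rule ccontr)
      assume "\<not> e < d"
      then have "?G (d * z) \<le> ?G (e * z)" using assms d e that by (subst hom_cdf_le_iff) auto
      with lt e show False by simp
    qed
    have "F x \<le> ?G (e * x)"
      using star_aboveD[OF star e(1), of z x] that e by simp
    moreover have "?G (e * x) < ?G (d * x)"
      using assms e \<open>e < d\<close> by (intro hom_cdf_strict_mono) auto
    ultimately show False using d by simp
  qed
  have limG: "((\<lambda>z. ?G (d * z) / z ^ Suc p) \<longlongrightarrow> real (Suc N choose Suc p) * d ^ Suc p) (at_right 0)"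
    using order_cdf_asymptotics[of "{..<Suc N}" "Suc p" "\<lambda>_. d"]
    by (simp add: elem_sym_const order_cdf_homogeneous del: power_Suc)
  have "real (Suc N choose Suc p) * d ^ Suc p \<le> s"
  proof (rule tendsto_le[OF _ lim limG])
    show "eventually (\<lambda>z. ?G (d * z) / z ^ Suc p \<le> F z / z ^ Suc p) (at_right 0)"
      using eventually_at_right_real[OF \<open>0 < x\<close>]
      by eventually_elim (use ge in \<open>auto intro!: divide_right_mono\<close>)
  qed simp
  also have "s \<le> real (Suc N choose Suc p) * c ^ Suc p" by fact
  also have "\<dots> < real (Suc N choose Suc p) * d ^ Suc p"
  proof (intro mult_strict_left_mono power_strict_mono)
    show "0 < real (Suc N choose Suc p)" using assms(1) by (simp del: binomial_Suc_Suc)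
  qed (use assms \<open>c < d\<close> in auto)
  finally show False by (simp only: less_irrefl)
qed

section \<open>Star order between heterogeneous and homogeneous order statistics\<close>

text \<open>
The mixture on the right equals \<open>H - (1 - \<theta>) * D\<close> with \<open>D = H - G\<close>, and \<open>D t\<close> is a multiple of
\<open>(1 - exp (- t)) * h t\<close> with \<open>h\<close> the density of \<open>H\<close>. So for \<open>c < 1\<close> it suffices that
\<open>(H x - H (c * x)) / D x\<close> increases in \<open>x\<close>. This quotient is the integral of \<open>x * h (x * u) / D x\<close> over
\<open>u\<close> in \<open>[c, 1]\<close>, and already the integrand increases in \<open>x\<close>.
\<close>

lemma hom_mixture_scaling:
  assumes "p \<le> N" "0 \<le> \<theta>" "\<theta> \<le> 1" "0 < c" "0 < x" "x \<le> y"
    and le: "hom_cdf (Suc p) (Suc N) (c * x) \<le>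
      \<theta> * hom_cdf (Suc p) (Suc N) x + (1 - \<theta>) * hom_cdf (Suc (Suc p)) (Suc (Suc N)) x"
  shows "hom_cdf (Suc p) (Suc N) (c * y) \<le>
      \<theta> * hom_cdf (Suc p) (Suc N) y + (1 - \<theta>) * hom_cdf (Suc (Suc p)) (Suc (Suc N)) y"
proof -
  let ?H = "hom_cdf (Suc p) (Suc N)" and ?h = "hom_pdf p N"
  define D where "D t = ?H t - hom_cdf (Suc (Suc p)) (Suc (Suc N)) t" for t
  have D: "real (Suc (Suc N)) * D t = hom_pdf (Suc p) (Suc N) t" for t
    unfolding D_def using assms by (intro hom_cdf_diff) auto
  have D_pos: "0 < D t" if "0 < t" for t
    using D[of t] hom_pdf_pos[OF that, of "Suc p" "Suc N"] assms
    by (metis Suc_le_mono of_nat_0_less_iff zero_less_Suc zero_less_mult_pos)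
  have mix: "\<theta> * ?H t + (1 - \<theta>) * hom_cdf (Suc (Suc p)) (Suc (Suc N)) t = ?H t - (1 - \<theta>) * D t" for t
    by (simp add: D_def algebra_simps)
  have "0 < y" using assms by simp
  have le': "(1 - \<theta>) * D x \<le> ?H x - ?H (c * x)" using le unfolding mix by simp
  show ?thesis
  proof (cases "c < 1")
    case False
    then have "?H x \<le> ?H (c * x)" using assms by (subst hom_cdf_le_iff) auto
    moreover have "0 \<le> (1 - \<theta>) * D x" using D_pos[of x] assms by (intro mult_nonneg_nonneg) auto
    ultimately have "(1 - \<theta>) * D x \<le> 0" "?H (c * x) \<le> ?H x" using le' by linarith+
    then have "\<theta> = 1" "c * x \<le> x"
      using D_pos[of x] assms hom_cdf_le_iff[OF assms(1), of "c * x" x] by (auto simp: mult_le_0_iff)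
    then have "c = 1" using False assms by (simp add: mult_le_cancel_right1)
    then show ?thesis using \<open>\<theta> = 1\<close> by simp
  next
    case True
    have kernel: "x * ?h (x * u) * D y \<le> y * ?h (y * u) * D x" if "0 < u" "u \<le> 1" for u
    proof -
      define b where "b = Suc N - p"
      have *: "0 \<le> 1 - exp (- v)" if "0 \<le> v" for v :: real using that by simp
      have 1: "x * (1 - exp (- y)) \<le> y * (1 - exp (- x))"
        using assms by (intro one_minus_exp_quotient_antimono)
      have "(1 - exp (- (u * x))) * (1 - exp (- y)) \<le> (1 - exp (- (u * y))) * (1 - exp (- x))"
        using assms that by (intro exp_dilation_ratio)
      then have 2: "((1 - exp (- (x * u))) * (1 - exp (- y))) ^ p \<le> ((1 - exp (- (y * u))) * (1 - exp (- x))) ^ p"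
        using assms that by (intro power_mono mult_nonneg_nonneg *) (auto simp: mult.commute)
      have "0 \<le> (y - x) * (1 - u)" using assms that by (intro mult_nonneg_nonneg) auto
      then have "exp (- (x * u)) * exp (- y) \<le> exp (- (y * u)) * exp (- x)"
        by (simp add: exp_add[symmetric] algebra_simps)
      then have 3: "(exp (- (x * u)) * exp (- y)) ^ b \<le> (exp (- (y * u)) * exp (- x)) ^ b"
        by (intro power_mono) auto
      have "(x * (1 - exp (- y))) * (((1 - exp (- (x * u))) * (1 - exp (- y))) ^ p * (exp (- (x * u)) * exp (- y)) ^ b)
         \<le> (y * (1 - exp (- x))) * (((1 - exp (- (y * u))) * (1 - exp (- x))) ^ p * (exp (- (y * u)) * exp (- x)) ^ b)"
        using assms that \<open>0 < y\<close> by (intro mult_mono 1 2 3 mult_nonneg_nonneg zero_le_power *) auto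
      then have "(real (Suc N) * real (N choose p) * (real (Suc (Suc N)) * real (Suc N choose Suc p))) * ((x * (1 - exp (- y))) * (((1 - exp (- (x * u))) * (1 - exp (- y))) ^ p * (exp (- (x * u)) * exp (- y)) ^ b))
         \<le> (real (Suc N) * real (N choose p) * (real (Suc (Suc N)) * real (Suc N choose Suc p))) * ((y * (1 - exp (- x))) * (((1 - exp (- (y * u))) * (1 - exp (- x))) ^ p * (exp (- (y * u)) * exp (- x)) ^ b))"
        by (intro mult_left_mono) auto
      then have "x * ?h (x * u) * (real (Suc (Suc N)) * D y) \<le> y * ?h (y * u) * (real (Suc (Suc N)) * D x)"
        unfolding D hom_pdf_def b_def by (simp add: power_mult_distrib mult_ac del: of_nat_Suc binomial_Suc_Suc)
      then have "real (Suc (Suc N)) * (x * ?h (x * u) * D y) \<le> real (Suc (Suc N)) * (y * ?h (y * u) * D x)"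
        by (simp only: mult_ac)
      then show ?thesis by (simp del: of_nat_Suc)
    qed
    \<comment> \<open>the kernel inequality, integrated over \<open>u\<close> in \<open>[c, 1]\<close>\<close>
    define \<phi> where "\<phi> u = ?H (x * u) * D y - ?H (y * u) * D x" for u
    have "\<phi> 1 \<le> \<phi> c"
    proof (rule DERIV_nonpos_imp_nonincreasing[where f = \<phi>])
      fix u assume u: "c \<le> u" "u \<le> 1"
      have "(\<phi> has_real_derivative (x * ?h (x * u) * D y - y * ?h (y * u) * D x)) (at u)"
        unfolding \<phi>_def
        by (rule derivative_eq_intros DERIV_chain2[OF hom_cdf_has_derivative[OF assms(1)]] refl | simp)+
      then show "\<exists>v. (\<phi> has_real_derivative v) (at u) \<and> v \<le> 0"
        using kernel[of u] u assms by force
    qed (use True in simp)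
    then have "(?H x - ?H (c * x)) * D y \<le> (?H y - ?H (c * y)) * D x"
      by (simp add: \<phi>_def algebra_simps)
    moreover have "(1 - \<theta>) * D x * D y \<le> (?H x - ?H (c * x)) * D y"
      using le' D_pos[OF \<open>0 < y\<close>] by (intro mult_right_mono) auto
    ultimately have "(1 - \<theta>) * D y * D x \<le> (?H y - ?H (c * y)) * D x"
      by (simp add: mult_ac)
    then have "(1 - \<theta>) * D y \<le> ?H y - ?H (c * y)" using D_pos[OF assms(5)] by simp
    then show ?thesis unfolding mix by simp
  qed
qed

text \<open>
Both \<open>F\<close> and the homogeneous distribution function solve a linear differential equation of the
first order. Multiplying by \<open>exp (L * x)\<close> removes the difference itself from the derivative.
\<close>

lemma exp_weighted_gap_derivative:
  assumes "p \<le> N" and "0 < L"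
    and F: "\<And>x. (F has_real_derivative L * (Z x - F x)) (at x)"
  shows "((\<lambda>x. exp (L * x) * (F x - hom_cdf (Suc (Suc p)) (Suc (Suc N)) (c * x))) has_real_derivative
     L * exp (L * x) * (Z x - ((real (Suc (Suc N)) * c / L) * hom_cdf (Suc p) (Suc N) (c * x)
       + (1 - real (Suc (Suc N)) * c / L) * hom_cdf (Suc (Suc p)) (Suc (Suc N)) (c * x)))) (at x)"
proof -
  let ?G = "hom_cdf (Suc (Suc p)) (Suc (Suc N))" and ?H = "hom_cdf (Suc p) (Suc N)"
  have g: "(?G has_real_derivative real (Suc (Suc N)) * (?H t - ?G t)) (at t)" for t
    using hom_cdf_has_derivative[of "Suc p" "Suc N" t] hom_cdf_diff[of "Suc p" "Suc N" t] assms by simp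
  show ?thesis
    using assms(2)
    by - (rule derivative_eq_intros DERIV_chain2[OF g] F refl | simp add: field_simps)+
qed

text \<open>
The weighted gap \<open>W\<close> vanishes at \<open>0\<close>. If it is nonpositive at \<open>x\<close>, its derivative is nonpositive at some
earlier point \<open>s\<close>; by the single crossing of \<open>Z\<close> and the mixture \<open>K\<close> the derivative then remains
nonpositive, and so does \<open>W\<close>.
\<close>

lemma star_step:
  assumes "p \<le> N" "0 < L" "0 < c" "real (Suc (Suc N)) * c \<le> L"
    and F: "\<And>x. (F has_real_derivative L * (Z x - F x)) (at x)" and F0: "F 0 = 0"
    and Z: "star_above Z (hom_cdf (Suc p) (Suc N))"
    and "0 < x" "x \<le> y" and le: "F x \<le> hom_cdf (Suc (Suc p)) (Suc (Suc N)) (c * x)"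
  shows "F y \<le> hom_cdf (Suc (Suc p)) (Suc (Suc N)) (c * y)"
proof -
  let ?G = "hom_cdf (Suc (Suc p)) (Suc (Suc N))" and ?H = "hom_cdf (Suc p) (Suc N)"
  define \<theta> where "\<theta> = real (Suc (Suc N)) * c / L"
  define K where "K t = \<theta> * ?H t + (1 - \<theta>) * ?G t" for t
  define W where "W s = exp (L * s) * (F s - ?G (c * s))" for s
  have \<theta>: "0 < \<theta>" "\<theta> \<le> 1" using assms by (auto simp: \<theta>_def)
  have dW: "(W has_real_derivative L * exp (L * s) * (Z s - K (c * s))) (at s)" for s
    unfolding W_def K_def \<theta>_def by (rule exp_weighted_gap_derivative[OF assms(1,2) F])
  have "W x \<le> 0" using le by (simp add: W_def mult_le_0_iff)
  have "W 0 = 0" by (simp add: W_def F0 hom_cdf_at_0)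
  obtain s where s: "0 < s" "s < x" "W x - W 0 = (x - 0) * (L * exp (L * s) * (Z s - K (c * s)))"
    using MVT2[OF \<open>0 < x\<close>, of W, OF dW] by blast
  then have "x * (L * exp (L * s) * (Z s - K (c * s))) \<le> 0"
    using \<open>W x \<le> 0\<close> \<open>W 0 = 0\<close> by simp
  then have Zs: "Z s \<le> K (c * s)"
    using \<open>0 < x\<close> \<open>0 < L\<close> by (simp add: mult_le_0_iff)
  have cs: "0 < c * s" using s assms by simp
  have HG: "?G t \<le> ?H t" if "0 < t" for t
  proof -
    have "0 < real (Suc (Suc N)) * (?H t - ?G t)"
      using hom_cdf_diff[of "Suc p" "Suc N" t] hom_pdf_pos[OF that, of "Suc p" "Suc N"] assms(1) by simp
    then show ?thesis by (simp add: zero_less_mult_iff)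
  qed
  have "0 < ?H (c * s)" "?H (c * s) < 1" "0 < ?G (c * s)"
    using cs hom_cdf_strict_mono[of p N 0 "c * s"] hom_cdf_strict_mono[of "Suc p" "Suc N" 0 "c * s"] assms(1)
      hom_cdf_less_1[of "c * s" p "Suc N"]
    by (auto simp: hom_cdf_at_0)
  moreover have "K (c * s) \<le> \<theta> * ?H (c * s) + (1 - \<theta>) * ?H (c * s)"
    unfolding K_def using \<theta> HG[OF cs] by (intro add_left_mono mult_left_mono) auto
  moreover have "\<dots> = ?H (c * s)" by (simp add: algebra_simps)
  moreover have "0 < K (c * s)"
    using \<theta> calculation by (auto simp: K_def intro!: add_pos_nonneg)
  ultimately have "0 < K (c * s)" "K (c * s) < 1" by auto
  \<comment> \<open>\<open>Z\<close> and \<open>K (c * z)\<close> are separated by \<open>H (d * z)\<close>, which meets the latter at \<open>s\<close>\<close>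
  then obtain d where d: "0 < d" "?H (d * s) = K (c * s)"
    using hom_cdf_scale_attains[OF assms(1) _ _ s(1)] by blast
  have R: "Z z \<le> K (c * z)" if "s \<le> z" for z
  proof -
    have "Z z \<le> ?H (d * z)" using star_aboveD[OF Z d(1) s(1) that] d Zs by simp
    also have "\<dots> = ?H (d / c * (c * z))" using assms by simp
    also have "\<dots> \<le> K (c * z)"
      unfolding K_def
    proof (rule hom_mixture_scaling[OF assms(1)])
      show "?H (d / c * (c * s)) \<le> \<theta> * ?H (c * s) + (1 - \<theta>) * ?G (c * s)"
        using d assms by (simp add: K_def)
    qed (use \<theta> d assms s that in auto)
    finally show ?thesis .
  qed
  have "W y \<le> W x"
  proof (rule DERIV_nonpos_imp_nonincreasing[OF \<open>x \<le> y\<close>])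
    fix z assume "x \<le> z" "z \<le> y"
    then have "L * exp (L * z) * (Z z - K (c * z)) \<le> 0"
      using R[of z] s \<open>0 < L\<close> by (intro mult_nonneg_nonpos) auto
    then show "\<exists>v. (W has_real_derivative v) (at z) \<and> v \<le> 0" using dW[of z] by blast
  qed
  then have "W y \<le> 0" using \<open>W x \<le> 0\<close> by simp
  then show ?thesis by (simp add: W_def mult_le_0_iff)
qed

text \<open>
The boundary case \<open>\<theta> = 1\<close> of the same comparison, in which the mixture \<open>K\<close> is \<open>H\<close> alone.
\<close>

lemma dominated_step:
  assumes "p \<le> N" "0 < L" "0 < c" "real (Suc (Suc N)) * c = L"
    and F: "\<And>x. (F has_real_derivative L * (Z x - F x)) (at x)" and F0: "F 0 = 0"
    and Z: "\<And>x. 0 < x \<Longrightarrow> Z x \<le> hom_cdf (Suc p) (Suc N) (c * x)"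
    and "0 < x"
  shows "F x \<le> hom_cdf (Suc (Suc p)) (Suc (Suc N)) (c * x)"
proof -
  let ?G = "hom_cdf (Suc (Suc p)) (Suc (Suc N))" and ?H = "hom_cdf (Suc p) (Suc N)"
  define W where "W s = exp (L * s) * (F s - ?G (c * s))" for s
  have "real (Suc (Suc N)) * c / L = 1" using assms(2,4) by simp
  note \<theta> = this
  have dW: "(W has_real_derivative L * exp (L * s) * (Z s - ?H (c * s))) (at s)" for s
    using exp_weighted_gap_derivative[OF assms(1,2) F, of c s]
    unfolding W_def \<theta> diff_self mult_1 mult_zero_left add_0_right .
  have "W x \<le> W 0"
  proof (rule DERIV_nonpos_imp_decreasing_open[where f = W])
    fix z assume "0 < z" "z < x"
    then have "L * exp (L * z) * (Z z - ?H (c * z)) \<le> 0"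
      using Z[of z] \<open>0 < L\<close> by (intro mult_nonneg_nonpos) auto
    then show "\<exists>v. (W has_real_derivative v) (at z) \<and> v \<le> 0" using dW[of z] by blast
  next
    show "continuous_on {0..x} W"
      using dW by (meson DERIV_isCont continuous_at_imp_continuous_on)
  qed (use assms in simp)
  then have "W x \<le> 0" by (simp add: W_def F0 hom_cdf_at_0)
  then show ?thesis by (simp add: W_def mult_le_0_iff)
qed

text \<open>
For \<open>c\<close> at most the mean rate \<open>c0\<close> this is \<open>star_step\<close>. For larger \<open>c\<close> the distribution function is
dominated outright: the coefficient of \<open>Z\<close> at \<open>0\<close> is a multiple of \<open>elem_sym (Suc (Suc p)) I a\<close>,
which Maclaurin's inequality bounds by its value at equal rates.
\<close>

lemma order_cdf_star:
  assumes "finite I" "card I = Suc N" "p \<le> N" "\<And>i. i \<in> I \<Longrightarrow> 0 < a i"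
  shows "star_above (order_cdf (Suc p) I a) (hom_cdf (Suc p) (Suc N))"
  using assms
proof (induction p arbitrary: I N)
  case 0
  define L where "L = (\<Sum>i\<in>I. a i)"
  have G: "hom_cdf (Suc 0) (Suc N) t = 1 - exp (- (real (Suc N) * t))" for t
    by (simp add: hom_cdf_def order_cdf_Suc_0)
  have F: "order_cdf (Suc 0) I a x = 1 - exp (- (L * x))" for x
    using 0 by (simp add: order_cdf_Suc_0 L_def)
  show ?case
    unfolding star_above_def
  proof (intro allI impI)
    fix c x y :: real
    assume "0 < c" "0 < x" "x \<le> y" "order_cdf (Suc 0) I a x \<le> hom_cdf (Suc 0) (Suc N) (c * x)"
    then have "L * x \<le> real (Suc N) * c * x" by (simp add: F G mult.assoc del: of_nat_Suc)
    then have "L * y \<le> real (Suc N) * c * y"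
      using \<open>0 < x\<close> \<open>x \<le> y\<close> by (intro mult_right_mono) (auto simp del: of_nat_Suc)
    then show "order_cdf (Suc 0) I a y \<le> hom_cdf (Suc 0) (Suc N) (c * y)"
      by (simp add: F G mult.assoc del: of_nat_Suc)
  qed
next
  case (Suc p)
  obtain M where N: "N = Suc M" "p \<le> M" using Suc.prems by (cases N) auto
  let ?G = "hom_cdf (Suc (Suc p)) (Suc N)" and ?H = "hom_cdf (Suc p) (Suc M)"
  define L where "L = (\<Sum>i\<in>I. a i)"
  define Z where "Z x = (\<Sum>r\<in>I. a r / L * order_cdf (Suc p) (I - {r}) a x)" for x
  define c0 where "c0 = L / real (Suc N)"
  define F where "F = order_cdf (Suc (Suc p)) I a"
  have "I \<noteq> {}" using Suc.prems by auto
  then have "0 < L" unfolding L_def using Suc.prems by (intro sum_pos) auto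
  then have "0 < c0" by (simp add: c0_def)
  have dF: "(F has_real_derivative L * (Z x - F x)) (at x)" for x
  proof -
    have "(\<Sum>i\<in>I. a i * (order_cdf (Suc p) (I - {i}) a x - F x)) = L * (Z x - F x)"
      using \<open>0 < L\<close> by (simp add: Z_def right_diff_distrib sum_subtractf sum_distrib_left
          sum_distrib_right[symmetric] L_def[symmetric])
    then show ?thesis
      using order_cdf_has_derivative[OF Suc.prems(1), of "Suc p" a x] by (simp add: F_def)
  qed
  have F0: "F 0 = 0" using Suc.prems by (simp add: F_def order_cdf_at_0)
  have cardr: "card (I - {r}) = Suc M" if "r \<in> I" for r using Suc.prems that N by simp
  have range: "0 < order_cdf (Suc p) (I - {r}) a x \<and> order_cdf (Suc p) (I - {r}) a x < 1"
    if "r \<in> I" "0 < x" for r x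
    using that Suc.prems cardr N by (intro conjI order_cdf_pos order_cdf_less_1) auto
  have w: "0 \<le> a r / L" if "r \<in> I" for r using that Suc.prems \<open>0 < L\<close> by (simp add: less_imp_le)
  have w1: "(\<Sum>r\<in>I. a r / L) = 1" using \<open>0 < L\<close> by (simp add: L_def sum_divide_distrib[symmetric])
  have starZ: "star_above Z ?H"
    unfolding Z_def
  proof (rule star_above_mixture)
    show "star_above (order_cdf (Suc p) (I - {r}) a) ?H" if "r \<in> I" for r
      using Suc.IH[of "I - {r}" M] Suc.prems cardr[OF that] N by auto
  qed (use range w w1 N Suc.prems in auto)
  have rangeZ: "0 < Z x \<and> Z x < 1" if "0 < x" for x
  proof
    show "0 < Z x"
      unfolding Z_def using range[OF _ that] Suc.prems \<open>0 < L\<close> \<open>I \<noteq> {}\<close>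
      by (intro sum_pos mult_pos_pos divide_pos_pos) auto
    have "Z x < (\<Sum>r\<in>I. a r / L * 1)"
      unfolding Z_def using range[OF _ that] Suc.prems \<open>0 < L\<close> \<open>I \<noteq> {}\<close>
      by (intro sum_strict_mono mult_strict_left_mono divide_pos_pos) auto
    then show "Z x < 1" using w1 by simp
  qed
  have limZ: "((\<lambda>x. Z x / x ^ Suc p) \<longlongrightarrow> (\<Sum>r\<in>I. a r / L * elem_sym (Suc p) (I - {r}) a)) (at_right 0)"
    unfolding Z_def sum_divide_distrib times_divide_eq_right[symmetric]
    using Suc.prems by (intro tendsto_intros order_cdf_asymptotics) auto
  have "(\<Sum>r\<in>I. a r / L * elem_sym (Suc p) (I - {r}) a) = real (Suc (Suc p)) / L * elem_sym (Suc (Suc p)) I a"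
    using sum_mult_elem_sym_remove[OF Suc.prems(1), of a "Suc p"]
    by (simp add: sum_divide_distrib[symmetric])
  also have "\<dots> \<le> real (Suc (Suc p)) / L * (real (Suc N choose Suc (Suc p)) * c0 ^ Suc (Suc p))"
    using maclaurin_inequality[of I a "Suc (Suc p)", OF Suc.prems(1,4)] Suc.prems \<open>0 < L\<close>
    by (intro mult_left_mono) (auto simp: c0_def L_def)
  also have "\<dots> = real (Suc M choose Suc p) * c0 ^ Suc p"
  proof -
    have "real (Suc (Suc p)) * real (Suc N choose Suc (Suc p)) = real (Suc N) * real (Suc M choose Suc p)"
      using Suc_times_binomial_eq[of N "Suc p"] N by (metis mult.commute of_nat_mult)
    then have "real (Suc (Suc p)) / L * (real (Suc N choose Suc (Suc p)) * c0 ^ Suc (Suc p)) =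
       real (Suc N) * c0 / L * (real (Suc M choose Suc p) * c0 ^ Suc p)"
      by (simp add: field_simps del: of_nat_Suc binomial_Suc_Suc)
    also have "real (Suc N) * c0 / L = 1" using \<open>0 < L\<close> by (simp add: c0_def)
    finally show ?thesis by simp
  qed
  finally have Zdom: "Z x \<le> ?H (c0 * x)" if "0 < x" for x
    using star_above_dominated[OF N(2) starZ rangeZ limZ \<open>0 < c0\<close> _ that] by simp
  have Fdom: "F x \<le> ?G (c0 * x)" if "0 < x" for x
    using dominated_step[OF N(2) \<open>0 < L\<close> \<open>0 < c0\<close> _ dF F0 Zdom that] N by (simp add: c0_def)
  show ?case
    unfolding star_above_def F_def[symmetric]
  proof (intro allI impI)
    fix c x y :: real
    assume *: "0 < c" "0 < x" "x \<le> y" "F x \<le> ?G (c * x)"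
    show "F y \<le> ?G (c * y)"
    proof (cases "c \<le> c0")
      case True
      then have "real (Suc (Suc M)) * c \<le> L" using N by (simp add: c0_def field_simps)
      then show ?thesis using star_step[OF N(2) \<open>0 < L\<close> *(1) _ dF F0 starZ *(2,3)] *(4) N by simp
    next
      case False
      have "F y \<le> ?G (c0 * y)" using * by (intro Fdom) auto
      also have "\<dots> \<le> ?G (c * y)" using * False \<open>0 < c0\<close> Suc.prems by (subst hom_cdf_le_iff) auto
      finally show ?thesis .
    qed
  qed
qed

section \<open>From the star order to the three stochastic orders\<close>

text \<open>
Here \<open>F\<close> stands for the distribution function of the heterogeneous spacing, a mixture, and \<open>s\<close> for its
leading coefficient at \<open>0\<close>; only their relation to the homogeneous sample matters for the orders.
\<close>

locale star_comparison =
  fixes p N :: nat and g s :: real and F :: "real \<Rightarrow> real" and \<mu> \<nu> :: "real measure"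
  assumes p_le_N: "p \<le> N" and g_pos: "0 < g"
    and star: "star_above F (hom_cdf (Suc p) (Suc N))"
    and F_range: "\<And>x. 0 < x \<Longrightarrow> 0 < F x \<and> F x < 1"
    and F_0: "F 0 = 0"
    and F_strict_mono: "\<And>x y. 0 \<le> x \<Longrightarrow> x < y \<Longrightarrow> F x < F y"
    and F_cont: "continuous_on UNIV F"
    and F_at_top: "(F \<longlongrightarrow> 1) at_top"
    and F_asymptotics: "((\<lambda>x. F x / x ^ Suc p) \<longlongrightarrow> s) (at_right 0)"
    and cdf_\<mu>: "\<And>x. cdf \<mu> x = (if x < 0 then 0 else hom_cdf (Suc p) (Suc N) (g * x))"
    and cdf_\<nu>: "\<And>x. cdf \<nu> x = (if x < 0 then 0 else F x)"
begin

abbreviation G :: "real \<Rightarrow> real" where "G \<equiv> hom_cdf (Suc p) (Suc N)"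

lemma G_cont: "continuous_on A G"
  unfolding hom_cdf_def by (rule continuous_on_order_cdf) simp

lemma G_at_top: "(G \<longlongrightarrow> 1) at_top"
  unfolding hom_cdf_def using p_le_N by (intro order_cdf_tendsto_1) auto

lemma dominated_iff: "(\<forall>x>0. F x \<le> G (g * x)) \<longleftrightarrow> s \<le> real (Suc N choose Suc p) * g ^ Suc p"
proof
  assume le: "\<forall>x>0. F x \<le> G (g * x)"
  have limG: "((\<lambda>z. G (g * z) / z ^ Suc p) \<longlongrightarrow> real (Suc N choose Suc p) * g ^ Suc p) (at_right 0)"
    using order_cdf_asymptotics[of "{..<Suc N}" "Suc p" "\<lambda>_. g"]
    by (simp add: elem_sym_const order_cdf_homogeneous del: power_Suc)
  show "s \<le> real (Suc N choose Suc p) * g ^ Suc p"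
  proof (rule tendsto_le[OF _ limG F_asymptotics])
    show "eventually (\<lambda>z. F z / z ^ Suc p \<le> G (g * z) / z ^ Suc p) (at_right 0)"
      using eventually_at_right_less[of 0]
      by eventually_elim (use le in \<open>auto intro!: divide_right_mono\<close>)
  qed simp
next
  assume "s \<le> real (Suc N choose Suc p) * g ^ Suc p"
  then show "\<forall>x>0. F x \<le> G (g * x)"
    using star_above_dominated[OF p_le_N star F_range F_asymptotics g_pos] by blast
qed

lemma st_iff: "st_order \<mu> \<nu> \<longleftrightarrow> (\<forall>x>0. F x \<le> G (g * x))"
proof
  assume st: "st_order \<mu> \<nu>"
  show "\<forall>x>0. F x \<le> G (g * x)"
  proof (intro allI impI)
    fix x :: real assume "0 < x"
    then show "F x \<le> G (g * x)" using st[unfolded st_order_def, rule_format, of x] by (simp add: cdf_\<mu> cdf_\<nu>)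
  qed
next
  assume le: "\<forall>x>0. F x \<le> G (g * x)"
  have "F x \<le> G (g * x)" if "0 \<le> x" for x
    using le that by (cases "x = 0") (auto simp: F_0 hom_cdf_at_0)
  then show "st_order \<mu> \<nu>" by (simp add: st_order_def cdf_\<mu> cdf_\<nu>)
qed

lemma G_range: "0 < x \<Longrightarrow> 0 < G (g * x) \<and> G (g * x) < 1"
  using hom_cdf_strict_mono[OF p_le_N, of 0 "g * x"] hom_cdf_less_1[of "g * x" p "Suc N"] g_pos
  by (simp add: hom_cdf_at_0)

text \<open>
With \<open>K\<close> as in \<open>hom_cdf_tangent\<close> for \<open>\<rho> = y / x\<close>, the star order gives \<open>F y \<le> K (F x)\<close>, while
\<open>G (g * y) = K (G (g * x))\<close>. As \<open>K\<close> is concave with \<open>K 1 = 1\<close>, the slope \<open>(1 - K u) / (1 - u)\<close>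
decreases in \<open>u\<close>, and \<open>F x \<le> G (g * x)\<close>. In the tangent inequality the value \<open>u = 1\<close> is reached by
letting \<open>t\<close> tend to infinity.
\<close>

lemma dominated_imp_hazard_ratio_mono:
  assumes le: "\<forall>x>0. F x \<le> G (g * x)" and xy: "0 < x" "x \<le> y"
  shows "(1 - F x) / (1 - G (g * x)) \<le> (1 - F y) / (1 - G (g * y))"
proof -
  have "0 < y" using xy by simp
  obtain \<kappa> where k: "0 \<le> \<kappa>"
    "\<And>t. 0 \<le> t \<Longrightarrow> G (y / x * t) - G (y / x * (g * x)) \<le> \<kappa> * (G t - G (g * x))"
    using hom_cdf_tangent[OF p_le_N, of "y / x" "g * x"] g_pos xy by auto
  have lim: "((\<lambda>t. G (y / x * t)) \<longlongrightarrow> 1) at_top"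
    using xy by (intro filterlim_compose[OF G_at_top] filterlim_tendsto_pos_mult_at_top[OF tendsto_const]
        filterlim_ident) auto
  have inf: "1 - G (g * y) \<le> \<kappa> * (1 - G (g * x))"
  proof (rule tendsto_le)
    show "((\<lambda>t. \<kappa> * (G t - G (g * x))) \<longlongrightarrow> \<kappa> * (1 - G (g * x))) at_top"
      by (intro tendsto_intros G_at_top)
    show "((\<lambda>t. G (y / x * t) - G (g * y)) \<longlongrightarrow> 1 - G (g * y)) at_top"
      by (intro tendsto_intros lim)
    show "eventually (\<lambda>t. G (y / x * t) - G (g * y) \<le> \<kappa> * (G t - G (g * x))) at_top"
      using eventually_ge_at_top[of 0]
      by eventually_elim (use k(2) xy in \<open>auto simp: mult_ac\<close>)
  qed simp
  obtain e where e: "0 < e" "G (e * x) = F x"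
    using hom_cdf_scale_attains[OF p_le_N, of "F x" x] F_range[OF xy(1)] xy by blast
  have "F y \<le> G (e * y)" using star_aboveD[OF star e(1) xy] e by simp
  moreover have "G (e * y) - G (g * y) \<le> \<kappa> * (F x - G (g * x))"
    using k(2)[of "e * x"] e xy by (simp add: mult_ac)
  ultimately have below: "(1 - G (g * y)) + \<kappa> * ((1 - F x) - (1 - G (g * x))) \<le> 1 - F y"
    by (simp add: algebra_simps)
  define a b a' b' where "a = 1 - F x" "b = 1 - G (g * x)" "a' = 1 - F y" "b' = 1 - G (g * y)"
  note ab = this
  have pos: "0 < b" "0 < b'" using G_range xy \<open>0 < y\<close> by (auto simp: ab)
  have "b \<le> a" using le xy by (simp add: ab)
  have "a * b' = b' * b + b' * (a - b)" by (simp add: algebra_simps)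
  also have "\<dots> \<le> b' * b + (\<kappa> * b) * (a - b)"
    using inf \<open>b \<le> a\<close> by (intro add_left_mono mult_right_mono) (auto simp: ab)
  also have "\<dots> = (b' + \<kappa> * (a - b)) * b" by (simp add: algebra_simps)
  also have "\<dots> \<le> a' * b" using below pos by (intro mult_right_mono) (auto simp: ab)
  finally have "a * b' \<le> a' * b" .
  then have "a / b \<le> a' / b'" using pos by (simp add: divide_simps)
  then show ?thesis by (simp add: ab)
qed

text \<open>
The ratio of survival functions is \<open>1\<close> at \<open>0\<close>, so if it increases it is at least \<open>1\<close>.
\<close>

lemma hr_iff: "hr_order \<mu> \<nu> \<longleftrightarrow> (\<forall>x>0. F x \<le> G (g * x))"
proof -
  define R where "R x = (1 - F x) / (1 - G (g * x))" for x
  have dom: "{x. 0 < x \<and> cdf \<mu> x < 1} = {0<..}" using G_range by (auto simp: cdf_\<mu>)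
  have "hr_order \<mu> \<nu> \<longleftrightarrow> mono_on {0<..} R"
    unfolding hr_order_def dom by (auto simp: mono_on_def R_def cdf_\<mu> cdf_\<nu>)
  also have "\<dots> \<longleftrightarrow> (\<forall>x>0. F x \<le> G (g * x))"
  proof
    assume mono: "mono_on {0<..} R"
    have "continuous_on {0..} R"
      unfolding R_def
    proof (intro continuous_intros continuous_on_compose2[OF G_cont[of UNIV]] continuous_on_subset[OF F_cont] ballI)
      fix x :: real assume "x \<in> {0..}"
      then show "1 - G (g * x) \<noteq> 0" using hom_cdf_less_1[of "g * x" p "Suc N"] g_pos by simp
    qed auto
    then have lim: "(R \<longlongrightarrow> R 0) (at_right 0)"
      by (auto simp: continuous_on intro: tendsto_within_subset)
    show "\<forall>x>0. F x \<le> G (g * x)"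
    proof (intro allI impI)
      fix x :: real assume "0 < x"
      have "R 0 \<le> R x"
      proof (rule tendsto_upperbound[OF lim])
        show "eventually (\<lambda>z. R z \<le> R x) (at_right 0)"
          using eventually_at_right_real[OF \<open>0 < x\<close>]
          by eventually_elim (use mono in \<open>auto simp: mono_on_def\<close>)
      qed simp
      then show "F x \<le> G (g * x)"
        using G_range[OF \<open>0 < x\<close>] by (simp add: R_def F_0 hom_cdf_at_0 field_simps)
    qed
  next
    assume "\<forall>x>0. F x \<le> G (g * x)"
    then show "mono_on {0<..} R"
      using dominated_imp_hazard_ratio_mono by (auto simp: mono_on_def R_def)
  qed
  finally show ?thesis .
qed

lemma right_cont_inverse_eq:
  assumes "\<And>x. cdf M x = (if x < 0 then 0 else H x)" "0 < x"
    "\<And>x y. 0 \<le> x \<Longrightarrow> x < y \<Longrightarrow> H x < H y" "H 0 = (0 :: real)"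
  shows "right_cont_inverse (cdf M) (H x) = x"
proof -
  have pos: "0 < H x" using assms(3)[of 0 x] assms(2,4) by simp
  have "{z. H x < cdf M z} = {x<..}"
  proof (intro set_eqI iffI)
    fix z assume "z \<in> {z. H x < cdf M z}"
    then have z: "0 \<le> z" "H x < H z" using pos by (auto simp: assms(1) split: if_splits)
    then show "z \<in> {x<..}" using assms(3)[of z x] by (cases z x rule: linorder_cases) auto
  qed (use assms in auto)
  then show ?thesis by (simp add: right_cont_inverse_def)
qed

lemma inverse_\<nu>: "0 < x \<Longrightarrow> right_cont_inverse (cdf \<nu>) (F x) = x"
  using right_cont_inverse_eq[OF cdf_\<nu>] F_strict_mono F_0 by blast

lemma inverse_\<mu>: "0 < x \<Longrightarrow> right_cont_inverse (cdf \<mu>) (G (g * x)) = x"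
  using right_cont_inverse_eq[of \<mu> "\<lambda>x. G (g * x)", OF cdf_\<mu>] hom_cdf_strict_mono[OF p_le_N] g_pos
  by (simp add: hom_cdf_at_0)

lemma F_attains:
  assumes "0 < u" "u < 1"
  shows "\<exists>x>0. F x = u"
proof -
  have "eventually (\<lambda>t. u < F t \<and> 0 < t) at_top"
    using assms F_at_top by (intro eventually_conj order_tendstoD eventually_gt_at_top) auto
  then obtain t where t: "u < F t" "0 < t" by (auto simp: eventually_at_top_linorder)
  have "\<exists>x. 0 \<le> x \<and> x \<le> t \<and> F x = u"
    using t assms by (intro IVT' continuous_on_subset[OF F_cont]) (auto simp: F_0)
  then obtain x where "0 \<le> x" "F x = u" by auto
  moreover have "x \<noteq> 0" using calculation assms F_0 by auto
  ultimately show ?thesis by (intro exI[of _ x]) auto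
qed

text \<open>
From the dispersive to the usual order, let the smaller quantile tend to \<open>0\<close>. Conversely, write
\<open>x, x'\<close> and \<open>y, y'\<close> for the quantiles of \<open>\<nu>\<close> and \<open>\<mu>\<close> at \<open>u < v\<close>. The star order gives \<open>y' / y \<le> x' / x\<close> and
domination gives \<open>y \<le> x\<close>, hence \<open>y' - y \<le> y * (x' / x - 1) \<le> x' - x\<close>.
\<close>

lemma disp_iff: "disp_order \<mu> \<nu> \<longleftrightarrow> (\<forall>x>0. F x \<le> G (g * x))"
proof
  assume disp: "disp_order \<mu> \<nu>"
  show "\<forall>x>0. F x \<le> G (g * x)"
  proof (intro allI impI)
    fix x :: real assume x: "0 < x"
    obtain y where y: "0 < y" "G (y * g) = F x"
      using hom_cdf_scale_attains[OF p_le_N, of "F x" g] F_range[OF x] g_pos by blast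
    have "y \<le> x"
    proof (rule field_le_epsilon)
      fix e :: real assume "0 < e"
      define d where "d = min e (y / 2)"
      have d: "0 < d" "d < y" "d \<le> e" using \<open>0 < e\<close> y by (auto simp: d_def)
      obtain z where z: "0 < z" "F z = G (g * d)"
        using F_attains[of "G (g * d)"] G_range[OF d(1)] by blast
      have "G (g * d) < G (g * y)" using d g_pos by (intro hom_cdf_strict_mono p_le_N) auto
      then have "right_cont_inverse (cdf \<mu>) (G (g * y)) - right_cont_inverse (cdf \<mu>) (G (g * d))
         \<le> right_cont_inverse (cdf \<nu>) (G (g * y)) - right_cont_inverse (cdf \<nu>) (G (g * d))"
        using disp G_range d(1) y(1) unfolding disp_order_def by blast
      moreover have "right_cont_inverse (cdf \<nu>) (G (g * y)) = x"
        using inverse_\<nu>[OF x] y by (simp add: mult.commute)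
      moreover have "right_cont_inverse (cdf \<nu>) (G (g * d)) = z"
        using inverse_\<nu>[OF z(1)] z by simp
      ultimately show "y \<le> x + e" using inverse_\<mu> y d z by simp
    qed
    then show "F x \<le> G (g * x)"
      using y g_pos x by (subst y(2)[symmetric], subst hom_cdf_le_iff[OF p_le_N]) auto
  qed
next
  assume le: "\<forall>x>0. F x \<le> G (g * x)"
  show "disp_order \<mu> \<nu>"
    unfolding disp_order_def
  proof (intro allI impI)
    fix u v :: real assume uv: "0 < u \<and> u < v \<and> v < 1"
    obtain x where x: "0 < x" "F x = u" using F_attains[of u] uv by auto
    obtain x' where x': "0 < x'" "F x' = v" using F_attains[of v] uv by auto
    obtain y where y: "0 < y" "G (y * g) = u"
      using hom_cdf_scale_attains[OF p_le_N, of u g] uv g_pos by auto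
    obtain y' where y': "0 < y'" "G (y' * g) = v"
      using hom_cdf_scale_attains[OF p_le_N, of v g] uv g_pos by auto
    have "x < x'"
      using F_strict_mono[of x' x] x x' uv by (cases x x' rule: linorder_cases) auto
    have "y \<le> x"
    proof -
      have "G (y * g) \<le> G (g * x)" using le[rule_format, of x] x y by simp
      then have "y * g \<le> g * x" using x y g_pos by (subst (asm) hom_cdf_le_iff[OF p_le_N]) auto
      then show ?thesis using g_pos by simp
    qed
    have "G (y' * g) \<le> G (g * y / x * x')"
      using star_aboveD[OF star, of "g * y / x" x x'] \<open>x < x'\<close> x x' y y' g_pos by (simp add: mult.commute)
    then have "y' * g \<le> g * y / x * x'"
      using x x' y y' g_pos by (subst (asm) hom_cdf_le_iff[OF p_le_N]) auto
    then have "y' \<le> y * (x' / x)" using g_pos x by (simp add: field_simps)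
    then have "y' - y \<le> y * (x' / x - 1)" by (simp add: algebra_simps)
    also have "\<dots> \<le> x * (x' / x - 1)"
      using \<open>y \<le> x\<close> \<open>x < x'\<close> x by (intro mult_right_mono) (auto simp: field_simps)
    also have "\<dots> = x' - x" using x by (simp add: field_simps)
    finally have "y' - y \<le> x' - x" .
    moreover have "right_cont_inverse (cdf \<nu>) u = x" "right_cont_inverse (cdf \<nu>) v = x'"
      "right_cont_inverse (cdf \<mu>) u = y" "right_cont_inverse (cdf \<mu>) v = y'"
      using inverse_\<nu>[OF x(1)] inverse_\<nu>[OF x'(1)] inverse_\<mu>[OF y(1)] inverse_\<mu>[OF y'(1)] x x' y y'
      by (auto simp: mult.commute)
    ultimately show "right_cont_inverse (cdf \<mu>) v - right_cont_inverse (cdf \<mu>) u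
          \<le> right_cont_inverse (cdf \<nu>) v - right_cont_inverse (cdf \<nu>) u" by simp
  qed
qed

lemma order_iff:
  assumes "ord \<in> {st_order, hr_order, disp_order}"
  shows "ord \<mu> \<nu> \<longleftrightarrow> s \<le> real (Suc N choose Suc p) * g ^ Suc p"
  using assms st_iff hr_iff disp_iff dominated_iff by auto

end

section \<open>Order statistics of real vectors\<close>

lemma sorted_nth_le_iff:
  fixes xs :: "'a :: linorder list"
  assumes "sorted xs" "k < length xs"
  shows "xs ! k \<le> t \<longleftrightarrow> k < length (filter (\<lambda>v. v \<le> t) xs)"
  using assms
proof (induction xs arbitrary: k)
  case (Cons a xs)
  show ?case
  proof (cases "a \<le> t")
    case True
    then show ?thesis using Cons by (cases k) auto
  next
    case False
    then have gt: "\<not> v \<le> t" if "v \<in> set (a # xs)" for v using Cons.prems that by auto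
    then have "filter (\<lambda>v. v \<le> t) (a # xs) = []" by (simp add: filter_empty_conv)
    moreover have "\<not> (a # xs) ! k \<le> t" using Cons.prems gt[OF nth_mem] by blast
    ultimately show ?thesis by simp
  qed
qed simp

lemma order_statistic_le_iff:
  assumes "1 \<le> j" "j \<le> n"
  shows "order_statistic j n x \<le> t \<longleftrightarrow> j \<le> card {i \<in> {1..n}. x i \<le> t}"
proof -
  let ?xs = "map x [1..<Suc n]"
  have "length (filter (\<lambda>v. v \<le> t) (sort ?xs)) = length (filter (\<lambda>v. v \<le> t) ?xs)"
    by (simp add: filter_sort)
  also have "\<dots> = card (set (filter (\<lambda>i. x i \<le> t) [1..<Suc n]))"
    unfolding filter_map length_map by (subst distinct_card) (simp_all add: o_def del: upt_Suc)
  also have "set (filter (\<lambda>i. x i \<le> t) [1..<Suc n]) = {i \<in> {1..n}. x i \<le> t}"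
    by (simp only: set_filter set_upt atLeastLessThanSuc_atLeastAtMost)
  finally have len: "length (filter (\<lambda>v. v \<le> t) (sort ?xs)) = card {i \<in> {1..n}. x i \<le> t}" .
  have "sort ?xs ! (j - 1) \<le> t \<longleftrightarrow> j - 1 < length (filter (\<lambda>v. v \<le> t) (sort ?xs))"
    by (rule sorted_nth_le_iff) (use assms in \<open>simp_all del: upt_Suc\<close>)
  then show ?thesis
    unfolding order_statistic_def len using assms(1) by linarith
qed

lemma order_statistic_cong:
  assumes "\<And>i. i \<in> {1..n} \<Longrightarrow> x i = y i"
  shows "order_statistic j n x = order_statistic j n y"
proof -
  have "map x [1..<Suc n] = map y [1..<Suc n]" using assms by (intro map_cong) auto
  then show ?thesis by (simp only: order_statistic_def)
qed

lemma borel_measurable_order_statistic: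
  assumes "1 \<le> j" "j \<le> n" "\<And>i. i \<in> {1..n} \<Longrightarrow> X i \<in> borel_measurable M"
  shows "(\<lambda>\<omega>. order_statistic j n (\<lambda>i. X i \<omega>)) \<in> borel_measurable M"
proof (subst borel_measurable_iff_le, intro allI)
  fix t :: real
  have card: "real (card {i \<in> {1..n}. X i \<omega> \<le> t}) = (\<Sum>i\<in>{1..n}. indicator {..t} (X i \<omega>))" for \<omega>
  proof -
    have "real (card {i \<in> {1..n}. X i \<omega> \<le> t}) = (\<Sum>i\<in>{i \<in> {1..n}. X i \<omega> \<le> t}. 1)" by simp
    also have "\<dots> = (\<Sum>i\<in>{1..n}. if X i \<omega> \<le> t then 1 else 0)"
      by (rule sum.inter_filter) simp
    also have "\<dots> = (\<Sum>i\<in>{1..n}. indicator {..t} (X i \<omega>))"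
      by (intro sum.cong) (simp_all add: indicator_def)
    finally show ?thesis .
  qed
  have "(\<lambda>\<omega>. indicator {..t} (X i \<omega>) :: real) \<in> borel_measurable M" if "i \<in> {1..n}" for i
    using measurable_compose[OF assms(3)[OF that], of "indicator {..t}" borel] by simp
  then have "(\<lambda>\<omega>. real (card {i \<in> {1..n}. X i \<omega> \<le> t})) \<in> borel_measurable M"
    unfolding card by (intro borel_measurable_sum)
  then have "{\<omega> \<in> space M. real j \<le> real (card {i \<in> {1..n}. X i \<omega> \<le> t})} \<in> sets M"
    unfolding borel_measurable_iff_ge by blast
  then show "{\<omega> \<in> space M. order_statistic j n (\<lambda>i. X i \<omega>) \<le> t} \<in> sets M"
    by (simp only: order_statistic_le_iff[OF assms(1,2)] of_nat_le_iff)
qed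

text \<open>
The configuration that determines the spacing: \<open>i\<close> comes \<open>m\<close>-th, \<open>A\<close> is the set of the earlier indices,
and \<open>S\<close> that of the indices within distance \<open>a\<close> after \<open>i\<close>.
\<close>

lemma order_statistic_spacing_le_iff:
  fixes x :: "nat \<Rightarrow> real"
  assumes "1 \<le> m" "m < k" "k \<le> n" "0 \<le> a"
    and A: "A \<subseteq> {1..n}" "card A = m - 1" and i: "i \<in> {1..n} - A" and S: "S \<subseteq> {1..n} - A - {i}"
    and xA: "\<And>j. j \<in> A \<Longrightarrow> x j < x i"
    and xS: "\<And>j. j \<in> S \<Longrightarrow> x i < x j \<and> x j \<le> x i + a"
    and xR: "\<And>j. j \<in> {1..n} - A - {i} - S \<Longrightarrow> x i + a < x j"
  shows "order_statistic k n x - order_statistic m n x \<le> a \<longleftrightarrow> k - m \<le> card S"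
proof -
  have fin: "finite A" "finite S" using A S by (auto intro: finite_subset)
  have gt: "x i < x j" if "j \<in> {1..n} - A - {i}" for j
  proof (cases "j \<in> S")
    case True
    then show ?thesis using xS by blast
  next
    case False
    then have "x i + a < x j" using xR that by blast
    then show ?thesis using assms(4) by linarith
  qed
  have le_i: "{j \<in> {1..n}. x j \<le> x i} = insert i A"
  proof (intro set_eqI iffI)
    fix j assume "j \<in> {j \<in> {1..n}. x j \<le> x i}"
    then show "j \<in> insert i A" using gt[of j] leD by blast
  next
    fix j assume j: "j \<in> insert i A"
    then have "j \<in> {1..n}" using A i by blast
    moreover have "x j \<le> x i" using j xA[of j] by (elim insertE) auto
    ultimately show "j \<in> {j \<in> {1..n}. x j \<le> x i}" by blast
  qed
  have less_i: "{j \<in> {1..n}. x j \<le> t} \<subseteq> A" if "t < x i" for t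
  proof
    fix j assume "j \<in> {j \<in> {1..n}. x j \<le> t}"
    then have j: "j \<in> {1..n}" "x j < x i" using that by auto
    then show "j \<in> A" using gt[of j] less_asym by blast
  qed
  have "order_statistic m n x = x i"
  proof (rule antisym)
    show "order_statistic m n x \<le> x i"
      using assms(1-3) A fin i unfolding order_statistic_le_iff[OF assms(1) less_imp_le[OF less_le_trans[OF assms(2,3)]]] le_i
      by simp
    show "x i \<le> order_statistic m n x"
    proof (rule ccontr)
      assume "\<not> x i \<le> order_statistic m n x"
      then have "card {j \<in> {1..n}. x j \<le> order_statistic m n x} \<le> card A"
        using less_i fin by (intro card_mono) auto
      moreover have "m \<le> card {j \<in> {1..n}. x j \<le> order_statistic m n x}"
        using assms(1-3) by (subst order_statistic_le_iff[symmetric]) auto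
      ultimately show False using assms(1) A(2) by linarith
    qed
  qed
  then have "order_statistic k n x - order_statistic m n x \<le> a \<longleftrightarrow> order_statistic k n x \<le> x i + a"
    by (simp only: diff_le_eq add.commute)
  also have "\<dots> \<longleftrightarrow> k \<le> card {j \<in> {1..n}. x j \<le> x i + a}"
    using assms(1-3) by (intro order_statistic_le_iff) auto
  also have "{j \<in> {1..n}. x j \<le> x i + a} = A \<union> insert i S"
  proof (intro set_eqI iffI)
    fix j assume j: "j \<in> {j \<in> {1..n}. x j \<le> x i + a}"
    then show "j \<in> A \<union> insert i S" using xR[of j] leD by blast
  next
    fix j assume j: "j \<in> A \<union> insert i S"
    then have "j \<in> {1..n}" using A i S by blast
    moreover have "x j \<le> x i + a"
      using j
    proof (elim UnE insertE)
      assume "j \<in> A"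
      then show ?thesis using xA[of j] assms(4) by linarith
    next
      assume "j = i"
      then show ?thesis using assms(4) by simp
    next
      assume "j \<in> S"
      then show ?thesis using xS[of j] by blast
    qed
    ultimately show "j \<in> {j \<in> {1..n}. x j \<le> x i + a}" by blast
  qed
  also have "card (A \<union> insert i S) = card A + card (insert i S)"
    using fin i S by (intro card_Un_disjoint) auto
  also have "card (insert i S) = Suc (card S)" using fin S by (intro card_insert_disjoint) auto
  also have "k \<le> card A + Suc (card S) \<longleftrightarrow> k - m \<le> card S"
    using assms(1,2) A(2) by linarith
  finally show ?thesis .
qed

lemma order_statistic_mono:
  assumes "1 \<le> m" "m \<le> k" "k \<le> n"
  shows "order_statistic m n x \<le> order_statistic k n x"
proof -
  have "k \<le> card {i \<in> {1..n}. x i \<le> order_statistic k n x}"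
    using assms by (subst order_statistic_le_iff[symmetric]) auto
  then show ?thesis using assms by (subst order_statistic_le_iff) auto
qed

section \<open>Exponential laws\<close>

text \<open>
Nonpositive rates are replaced by \<open>1\<close> so that this is a probability measure for every \<open>b\<close>; product
measures over a family of such laws can then be formed without conditions on the rates.
\<close>

definition exp_law :: "real \<Rightarrow> real measure" where
  "exp_law b = density lborel (exponential_density (if 0 < b then b else 1))"

lemma exp_law_pos: "0 < b \<Longrightarrow> exp_law b = density lborel (exponential_density b)"
  by (simp add: exp_law_def)

lemma prob_space_exp_law: "prob_space (exp_law b)"
  unfolding exp_law_def by (rule prob_space_exponential_density) simp

lemma sets_exp_law [simp, measurable_cong]: "sets (exp_law b) = sets borel"
  by (simp add: exp_law_def)

lemma space_exp_law [simp]: "space (exp_law b) = UNIV"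
  by (simp add: exp_law_def)

lemma AE_exp_law_pos: "AE x in exp_law b. 0 \<le> x"
  unfolding exp_law_def by (subst AE_density) (auto simp: exponential_density_def)

lemma AE_exp_law_neq: "AE x in exp_law b. x \<noteq> t"
  unfolding exp_law_def by (subst AE_density) (use AE_lborel_singleton[of t] in \<open>auto elim: AE_mp\<close>)

lemma distributed_exp_law: "0 < b \<Longrightarrow> distributed (exp_law b) lborel (\<lambda>x. x) (exponential_density b)"
  unfolding distributed_def exp_law_pos
  by (auto simp: distr_id2 exponential_density_nonneg intro!: distr_id2)

lemma measure_exp_law_atMost:
  assumes "0 < b" "0 \<le> t"
  shows "measure (exp_law b) {..t} = 1 - exp (- (b * t))"
proof -
  interpret prob_space "exp_law b" by (rule prob_space_exp_law)
  show ?thesis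
    using exponential_distributedD_le[OF distributed_exp_law[OF assms(1)] assms(2,1)]
    by (simp add: atMost_def mult.commute)
qed

lemma measure_exp_law_lessThan:
  assumes "0 < b" "0 \<le> t"
  shows "measure (exp_law b) {..<t} = 1 - exp (- (b * t))"
proof -
  have "measure (exp_law b) {..<t} = measure (exp_law b) {..t}"
    using AE_exp_law_neq[where b = b and t = t] by (intro measure_eq_AE) (auto elim!: AE_mp simp: less_le)
  then show ?thesis using measure_exp_law_atMost[OF assms] by simp
qed

lemma measure_exp_law_greaterThan:
  assumes "0 < b" "0 \<le> t"
  shows "measure (exp_law b) {t<..} = exp (- (b * t))"
proof -
  interpret prob_space "exp_law b" by (rule prob_space_exp_law)
  show ?thesis
    using prob_compl[of "{..t}"] measure_exp_law_atMost[OF assms]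
    by (simp add: Compl_eq_Diff_UNIV[symmetric] flip: not_le add: Compl_atMost)
qed

lemma measure_exp_law_greaterThanAtMost:
  assumes "0 < b" "0 \<le> t" "t \<le> t'"
  shows "measure (exp_law b) {t<..t'} = exp (- (b * t)) - exp (- (b * t'))"
proof -
  interpret prob_space "exp_law b" by (rule prob_space_exp_law)
  have "{t<..t'} = {..t'} - {..t}" by auto
  then have "measure (exp_law b) {t<..t'} = measure (exp_law b) {..t'} - measure (exp_law b) {..t}"
    using assms by (simp add: finite_measure_Diff)
  then show ?thesis using assms by (simp add: measure_exp_law_atMost)
qed

text \<open>
The probability that independent exponential variables with rates \<open>l j\<close>, \<open>j \<in> A\<close>, all precede
another one of rate \<open>b\<close>.
\<close>

definition all_earlier :: "('i \<Rightarrow> real) \<Rightarrow> 'i set \<Rightarrow> real \<Rightarrow> real" where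
  "all_earlier l A b = (\<integral>t. (\<Prod>j\<in>A. 1 - exp (- (l j * t))) \<partial>exp_law b)"

lemma integrable_exp_law_bounded:
  assumes "f \<in> borel_measurable borel" "\<And>t. 0 \<le> t \<Longrightarrow> \<bar>f t\<bar> \<le> (1::real)"
  shows "integrable (exp_law b) f"
proof -
  interpret prob_space "exp_law b" by (rule prob_space_exp_law)
  show ?thesis
  proof (rule integrable_const_bound)
    show "AE t in exp_law b. norm (f t) \<le> 1"
      using AE_exp_law_pos[of b] by eventually_elim (use assms(2) in auto)
  qed (use assms(1) in simp)
qed

lemma prod_one_minus_exp_bound:
  assumes "\<And>j. j \<in> A \<Longrightarrow> 0 < l j" "0 \<le> (t :: real)"
  shows "0 \<le> (\<Prod>j\<in>A. 1 - exp (- (l j * t)))" "(\<Prod>j\<in>A. 1 - exp (- (l j * t))) \<le> 1"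
  using assms by (auto intro!: prod_nonneg prod_le_1 simp: less_imp_le)

text \<open>
A tilted exponential density is an exponential density of larger rate up to a constant, and the
constant \<open>b / (b + c)\<close> is the probability that a variable of rate \<open>b\<close> precedes one of rate \<open>c\<close>.
\<close>

lemma exp_law_tilt:
  assumes "0 < b" "0 \<le> c" "f \<in> borel_measurable borel"
  shows "(\<integral>t. exp (- (c * t)) * f t \<partial>exp_law b) = b / (b + c) * (\<integral>t. f t \<partial>exp_law (b + c))"
proof -
  have "exponential_density b t * (exp (- (c * t)) * f t) = b / (b + c) * (exponential_density (b + c) t * f t)" for t
  proof (cases "t < 0")
    case False
    have "exp (- (t * b)) * exp (- (c * t)) = exp (- (t * (b + c)))"
      by (simp add: exp_add[symmetric] algebra_simps)
    then show ?thesis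
      using False assms by (simp add: exponential_density_def mult_ac)
  qed (simp add: exponential_density_def)
  then show ?thesis
    using assms by (simp add: exp_law_pos integral_density exponential_density_nonneg)
qed

lemma all_earlier_empty: "all_earlier l {} b = 1"
proof -
  interpret prob_space "exp_law b" by (rule prob_space_exp_law)
  show ?thesis by (simp add: all_earlier_def prob_space[simplified])
qed

lemma all_earlier_insert:
  assumes "finite A" "i \<notin> A" "\<And>j. j \<in> insert i A \<Longrightarrow> 0 < l j" "0 < b"
  shows "all_earlier l (insert i A) b = all_earlier l A b - b / (b + l i) * all_earlier l A (b + l i)"
proof -
  let ?P = "\<lambda>t. \<Prod>j\<in>A. 1 - exp (- (l j * t))"
  have b: "\<bar>?P t\<bar> \<le> 1" if "0 \<le> t" for t
    using prod_one_minus_exp_bound[of A l t] assms(3) that by auto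
  have "integrable (exp_law b) ?P" by (rule integrable_exp_law_bounded) (use b in auto)
  moreover have "integrable (exp_law b) (\<lambda>t. exp (- (l i * t)) * ?P t)"
  proof (rule integrable_exp_law_bounded)
    fix t :: real assume t: "0 \<le> t"
    have "exp (- (l i * t)) \<le> 1" using assms(3)[of i] t by simp
    then show "\<bar>exp (- (l i * t)) * ?P t\<bar> \<le> 1"
      using b[OF t] by (simp only: abs_mult abs_exp_cancel) (intro mult_le_one, auto)
  qed auto
  moreover have "(\<Prod>j\<in>insert i A. 1 - exp (- (l j * t))) = ?P t - exp (- (l i * t)) * ?P t" for t
    using assms(1,2) by (simp add: algebra_simps)
  ultimately have "all_earlier l (insert i A) b = all_earlier l A b - (\<integral>t. exp (- (l i * t)) * ?P t \<partial>exp_law b)"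
    by (simp add: all_earlier_def)
  also have "(\<integral>t. exp (- (l i * t)) * ?P t \<partial>exp_law b) = b / (b + l i) * all_earlier l A (b + l i)"
    unfolding all_earlier_def using assms by (intro exp_law_tilt) (auto simp: less_imp_le)
  finally show ?thesis .
qed

text \<open>
Split according to the index \<open>i\<close> that comes last in \<open>A\<close>, which must precede the competing variable
and whose own competitors are the members of \<open>A - {i}\<close>. The identity is proved
algebraically by induction on \<open>A\<close>, where the term for \<open>A = {}\<close> cancels.
\<close>

lemma all_earlier_last:
  assumes "finite A" "\<And>j. j \<in> A \<Longrightarrow> 0 < l j" "0 < b"
  shows "all_earlier l A b = (\<Sum>i\<in>A. l i / (b + l i) * all_earlier l (A - {i}) (b + l i)) + (if A = {} then 1 else 0)"
  using assms
proof (induction A arbitrary: b rule: finite_induct)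
  case empty
  then show ?case by (simp add: all_earlier_empty)
next
  case (insert j A)
  let ?e = "if A = {} then 1 else 0 :: real"
  have pos: "0 < l i" if "i \<in> insert j A" for i using insert.prems that by auto
  have rem: "insert j A - {j} = A" using insert by auto
  have "l i / (b + l i) * all_earlier l (insert j A - {i}) (b + l i) =
      l i / (b + l i) * all_earlier l (A - {i}) (b + l i)
        - l i / (b + l j + l i) * all_earlier l (A - {i}) (b + l j + l i)" if "i \<in> A" for i
  proof -
    have "insert j A - {i} = insert j (A - {i})" using insert that by auto
    moreover have "all_earlier l (insert j (A - {i})) (b + l i) = all_earlier l (A - {i}) (b + l i)
        - (b + l i) / (b + l i + l j) * all_earlier l (A - {i}) (b + l i + l j)"
      using insert.hyps insert.prems pos[of i] pos that by (intro all_earlier_insert) (auto intro: add_pos_pos)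
    moreover have "b + l i + l j = b + l j + l i" by simp
    moreover have "b + l i \<noteq> 0" using pos[of i] insert.prems(2) that by auto
    ultimately show ?thesis by (simp add: right_diff_distrib)
  qed
  then have "(\<Sum>i\<in>A. l i / (b + l i) * all_earlier l (insert j A - {i}) (b + l i)) =
      (\<Sum>i\<in>A. l i / (b + l i) * all_earlier l (A - {i}) (b + l i))
        - (\<Sum>i\<in>A. l i / (b + l j + l i) * all_earlier l (A - {i}) (b + l j + l i))"
    by (simp add: sum_subtractf)
  also have "\<dots> = (all_earlier l A b - ?e) - (all_earlier l A (b + l j) - ?e)"
  proof -
    have "0 < b + l j" using pos[of j] insert.prems(2) by simp
    then show ?thesis
      using insert.IH[of b] insert.IH[of "b + l j"] insert.prems by simp
  qed
  finally have "(\<Sum>i\<in>insert j A. l i / (b + l i) * all_earlier l (insert j A - {i}) (b + l i)) =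
      l j / (b + l j) * all_earlier l A (b + l j) + (all_earlier l A b - all_earlier l A (b + l j))"
    using insert.hyps by (simp add: rem)
  also have "\<dots> = all_earlier l A b - b / (b + l j) * all_earlier l A (b + l j)"
  proof -
    have "l j / (b + l j) = 1 - b / (b + l j)"
      using pos[of j] insert.prems(2) by (simp add: field_simps)
    then show ?thesis by (simp add: left_diff_distrib)
  qed
  also have "\<dots> = all_earlier l (insert j A) b"
    using insert pos by (subst all_earlier_insert) auto
  finally show ?case by simp
qed

text \<open>
Conditioning on the coordinate \<open>i\<close>, given which the other coordinates are independently confined to
sets that may depend on its value.
\<close>

lemma emeasure_PiM_exp_law_condition:
  fixes l :: "'i \<Rightarrow> real"
  assumes "finite J" "i \<notin> J"
    and Q: "\<And>j t. j \<in> J \<Longrightarrow> Q j t \<in> sets borel"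
    and meas: "{x \<in> space (PiM (insert i J) (\<lambda>i. exp_law (l i))). \<forall>j\<in>J. x j \<in> Q j (x i)} \<in> sets (PiM (insert i J) (\<lambda>i. exp_law (l i)))"
  shows "emeasure (PiM (insert i J) (\<lambda>i. exp_law (l i)))
      {x \<in> space (PiM (insert i J) (\<lambda>i. exp_law (l i))). \<forall>j\<in>J. x j \<in> Q j (x i)}
    = (\<integral>\<^sup>+t. (\<Prod>j\<in>J. emeasure (exp_law (l j)) (Q j t)) \<partial>exp_law (l i))"
proof -
  interpret product_sigma_finite "\<lambda>i. exp_law (l i)"
    by (intro product_sigma_finite.intro prob_space_imp_sigma_finite prob_space_exp_law)
  let ?P = "\<lambda>I. PiM I (\<lambda>i. exp_law (l i))"
  let ?E = "{x \<in> space (?P (insert i J)). \<forall>j\<in>J. x j \<in> Q j (x i)}"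
  have "emeasure (?P (insert i J)) ?E = (\<integral>\<^sup>+x. indicator ?E x \<partial>?P (insert i J))"
    using meas by simp
  also have "\<dots> = (\<integral>\<^sup>+t. (\<integral>\<^sup>+x. indicator ?E (x(i := t)) \<partial>?P J) \<partial>exp_law (l i))"
    using assms(1,2) meas by (intro product_nn_integral_insert_rev) auto
  also have "\<dots> = (\<integral>\<^sup>+t. (\<Prod>j\<in>J. emeasure (exp_law (l j)) (Q j t)) \<partial>exp_law (l i))"
  proof (intro nn_integral_cong)
    fix t :: real
    have "(\<integral>\<^sup>+x. indicator ?E (x(i := t)) \<partial>?P J) = (\<integral>\<^sup>+x. indicator (Pi\<^sub>E J (\<lambda>j. Q j t)) x \<partial>?P J)"
    proof (intro nn_integral_cong)
      fix x assume x: "x \<in> space (?P J)"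
      then have "x(i := t) \<in> space (?P (insert i J))" by (auto simp: space_PiM PiE_iff extensional_def)
      moreover have "(\<forall>j\<in>J. (x(i := t)) j \<in> Q j ((x(i := t)) i)) \<longleftrightarrow> (\<forall>j\<in>J. x j \<in> Q j t)"
        using assms(2) by (auto split: if_splits)
      ultimately have "x(i := t) \<in> ?E \<longleftrightarrow> x \<in> Pi\<^sub>E J (\<lambda>j. Q j t)"
        using x by (auto simp: space_PiM PiE_iff)
      then show "indicator ?E (x(i := t)) = (indicator (Pi\<^sub>E J (\<lambda>j. Q j t)) x :: ennreal)"
        by (simp only: indicator_def)
    qed
    also have "\<dots> = emeasure (?P J) (Pi\<^sub>E J (\<lambda>j. Q j t))"
      using assms(1) Q by (intro nn_integral_indicator sets_PiM_I_finite) auto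
    also have "\<dots> = (\<Prod>j\<in>J. emeasure (exp_law (l j)) (Q j t))"
      using assms(1) Q by (intro emeasure_PiM) auto
    finally show "(\<integral>\<^sup>+x. indicator ?E (x(i := t)) \<partial>?P J) = (\<Prod>j\<in>J. emeasure (exp_law (l j)) (Q j t))" .
  qed
  finally show ?thesis .
qed

section \<open>The law of the first indices drawn\<close>

definition draws :: "'i set \<Rightarrow> nat \<Rightarrow> 'i list set" where
  "draws I m = {r. length r = m \<and> distinct r \<and> set r \<subseteq> I}"

text \<open>
The probability that \<open>r\<close> is the sequence of the earliest indices, in order of appearance: the next
index is \<open>i\<close> with probability proportional to \<open>l i\<close> among those that remain.
\<close>

definition draw_weight :: "'i set \<Rightarrow> ('i \<Rightarrow> real) \<Rightarrow> 'i list \<Rightarrow> real" where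
  "draw_weight I l r = (\<Prod>j<length r. l (r ! j) / ((\<Sum>i\<in>I. l i) - (\<Sum>i<j. l (r ! i))))"

lemma finite_draws: "finite I \<Longrightarrow> finite (draws I m)"
  unfolding draws_def by (rule finite_subset[OF _ finite_lists_length_eq[of I m]]) auto

lemma draw_weight_snoc:
  assumes "finite I" "distinct r" "set r \<subseteq> I"
  shows "draw_weight I l (r @ [i]) = draw_weight I l r * (l i / (\<Sum>j\<in>I - set r. l j))"
proof -
  have "(\<Sum>j<length r. l (r ! j)) = (\<Sum>j\<in>set r. l j)"
    using assms(2) by (simp add: sum_list_distinct_conv_sum_set[symmetric] sum_list_sum_nth atLeast0LessThan)
  moreover have "(\<Sum>j\<in>I - set r. l j) = (\<Sum>j\<in>I. l j) - (\<Sum>j\<in>set r. l j)"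
    using assms by (simp add: sum_diff)
  moreover have "(\<Sum>k<j. l ((r @ [i]) ! k)) = (\<Sum>k<j. l (r ! k))" if "j \<le> length r" for j
    using that by (intro sum.cong) (auto simp: nth_append)
  ultimately show ?thesis
    by (simp add: draw_weight_def nth_append cong: prod.cong_simp)
qed

text \<open>
Splitting off the last of the \<open>m + 1\<close> indices drawn.
\<close>

lemma sum_draws_Suc:
  assumes "finite I"
  shows "(\<Sum>r\<in>draws I (Suc m). draw_weight I l r * \<psi> (I - set r)) =
    (\<Sum>r\<in>draws I m. draw_weight I l r *
      (\<Sum>i\<in>I - set r. l i / (\<Sum>j\<in>I - set r. l j) * \<psi> (I - set r - {i})))"
proof -
  have eq: "draws I (Suc m) = (\<lambda>(r, i). r @ [i]) ` (SIGMA r:draws I m. I - set r)"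
  proof (intro set_eqI iffI)
    fix r assume r: "r \<in> draws I (Suc m)"
    then have "r \<noteq> []" by (auto simp: draws_def)
    then have "r = butlast r @ [last r]" by simp
    moreover have "(butlast r, last r) \<in> (SIGMA r:draws I m. I - set r)"
    proof -
      have "distinct (butlast r @ [last r])" "set (butlast r @ [last r]) \<subseteq> I"
        using r \<open>r \<noteq> []\<close> by (auto simp: draws_def simp del: distinct_append)
      then show ?thesis using r by (auto simp: draws_def)
    qed
    ultimately show "r \<in> (\<lambda>(r, i). r @ [i]) ` (SIGMA r:draws I m. I - set r)"
      by (intro image_eqI[of _ _ "(butlast r, last r)"]) auto
  qed (auto simp: draws_def)
  have inj: "inj_on (\<lambda>(r, i). r @ [i]) (SIGMA r:draws I m. I - set r)"
    by (auto simp: inj_on_def)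
  have "(\<Sum>r\<in>draws I (Suc m). draw_weight I l r * \<psi> (I - set r)) =
     (\<Sum>(r, i)\<in>(SIGMA r:draws I m. I - set r). draw_weight I l (r @ [i]) * \<psi> (I - set (r @ [i])))"
    unfolding eq by (subst sum.reindex[OF inj]) (simp add: case_prod_unfold)
  also have "\<dots> = (\<Sum>r\<in>draws I m. \<Sum>i\<in>I - set r. draw_weight I l (r @ [i]) * \<psi> (I - set (r @ [i])))"
    using assms by (subst sum.Sigma) (auto simp: finite_draws)
  also have "\<dots> = (\<Sum>r\<in>draws I m. draw_weight I l r *
      (\<Sum>i\<in>I - set r. l i / (\<Sum>j\<in>I - set r. l j) * \<psi> (I - set r - {i})))"
  proof (intro sum.cong refl)
    fix r assume r: "r \<in> draws I m"
    have "I - set (r @ [i]) = I - set r - {i}" for i by auto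
    then show "(\<Sum>i\<in>I - set r. draw_weight I l (r @ [i]) * \<psi> (I - set (r @ [i]))) =
       draw_weight I l r * (\<Sum>i\<in>I - set r. l i / (\<Sum>j\<in>I - set r. l j) * \<psi> (I - set r - {i}))"
      using r assms by (simp add: draws_def draw_weight_snoc sum_distrib_left mult.assoc)
  qed
  finally show ?thesis .
qed

lemma draws_0: "draws I 0 = {[]}"
  by (auto simp: draws_def)

lemma card_draws_remainder:
  assumes "finite I" "r \<in> draws I m"
  shows "card (I - set r) = card I - m"
  using assms by (simp add: draws_def card_Diff_subset distinct_card)

lemma sum_draw_weight:
  assumes "finite I" "\<And>i. i \<in> I \<Longrightarrow> 0 < l i" "m \<le> card I"
  shows "(\<Sum>r\<in>draws I m. draw_weight I l r) = 1"
  using assms(3)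
proof (induction m)
  case 0
  then show ?case by (simp add: draws_0 draw_weight_def)
next
  case (Suc m)
  have "(\<Sum>i\<in>I - set r. l i / (\<Sum>j\<in>I - set r. l j)) = 1" if "r \<in> draws I m" for r
  proof -
    have "I - set r \<noteq> {}" using card_draws_remainder[OF assms(1) that] Suc.prems by force
    then have "0 < (\<Sum>j\<in>I - set r. l j)" using assms by (intro sum_pos) auto
    then show ?thesis by (simp add: sum_divide_distrib[symmetric])
  qed
  then show ?case using sum_draws_Suc[OF assms(1), of l "\<lambda>_. 1" m] Suc by simp
qed

lemma draw_weight_pos:
  assumes "finite I" "\<And>i. i \<in> I \<Longrightarrow> 0 < l i" "r \<in> draws I m"
  shows "0 < draw_weight I l r"
proof -
  have "distinct r \<Longrightarrow> set r \<subseteq> I \<Longrightarrow> 0 < draw_weight I l r"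
  proof (induction r rule: rev_induct)
    case (snoc i r)
    then have "i \<in> I - set r" by auto
    then have "0 < (\<Sum>j\<in>I - set r. l j)" using assms(1,2) by (intro sum_pos) auto
    moreover have "0 < l i" using snoc.prems assms by auto
    ultimately show ?case using snoc assms(1) by (simp add: draw_weight_snoc)
  qed (simp add: draw_weight_def)
  then show ?thesis using assms(3) by (simp add: draws_def)
qed

lemma sum_subset_remove:
  fixes f :: "'i set \<Rightarrow> 'i \<Rightarrow> real"
  assumes "finite I"
  shows "(\<Sum>A | A \<subseteq> I \<and> card A = Suc m. \<Sum>i\<in>A. f (A - {i}) i) =
    (\<Sum>A | A \<subseteq> I \<and> card A = m. \<Sum>i\<in>I - A. f A i)"
proof -
  have "(\<Sum>A | A \<subseteq> I \<and> card A = Suc m. \<Sum>i\<in>A. f (A - {i}) i) =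
     (\<Sum>(A, i)\<in>(SIGMA A:{A. A \<subseteq> I \<and> card A = Suc m}. A). f (A - {i}) i)"
    using assms by (subst sum.Sigma) (auto intro: finite_subset)
  also have "\<dots> = (\<Sum>(A, i)\<in>(SIGMA A:{A. A \<subseteq> I \<and> card A = m}. I - A). f A i)"
    by (rule sum.reindex_bij_witness[where i = "\<lambda>(A, i). (insert i A, i)" and j = "\<lambda>(A, i). (A - {i}, i)"])
      (use assms in \<open>auto simp: insert_absorb finite_subset card_insert_if\<close>)
  also have "\<dots> = (\<Sum>A | A \<subseteq> I \<and> card A = m. \<Sum>i\<in>I - A. f A i)"
    using assms by (subst sum.Sigma) auto
  finally show ?thesis .
qed

text \<open>
On the left the earliest \<open>m\<close> indices are recorded as a set \<open>A\<close>, on the right in order. Both sides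
obey the recursion that splits off the last index drawn, provided that \<open>J A b\<close> satisfies the
recursion for the probability that \<open>A\<close> precedes a competitor of rate \<open>b\<close>.
\<close>

lemma sum_first_drawn:
  fixes J :: "'i set \<Rightarrow> real \<Rightarrow> real"
  assumes "finite I" "\<And>i. i \<in> I \<Longrightarrow> 0 < l i" "m < card I"
    and J_empty: "\<And>b. 0 < b \<Longrightarrow> J {} b = 1"
    and J_rec: "\<And>A b. A \<subseteq> I \<Longrightarrow> A \<noteq> {} \<Longrightarrow> 0 < b \<Longrightarrow> J A b = (\<Sum>i\<in>A. l i / (b + l i) * J (A - {i}) (b + l i))"
  shows "(\<Sum>A | A \<subseteq> I \<and> card A = m. J A (\<Sum>j\<in>I - A. l j) * \<psi> (I - A)) =
    (\<Sum>r\<in>draws I m. draw_weight I l r * \<psi> (I - set r))"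
  using assms(3)
proof (induction m arbitrary: \<psi>)
  case 0
  have "{A. A \<subseteq> I \<and> card A = 0} = {{}}" using assms(1) by (auto dest: finite_subset)
  moreover have "0 < (\<Sum>j\<in>I. l j)" using assms 0 by (intro sum_pos) auto
  ultimately show ?case using J_empty by (simp add: draws_0 draw_weight_def)
next
  case (Suc m)
  define L where "L A = (\<Sum>j\<in>I - A. l j)" for A
  have L: "0 < L A" if "A \<subseteq> I" "card A \<le> Suc m" for A
  proof -
    have "I - A \<noteq> {}" using that Suc.prems assms(1) by auto
    then show ?thesis unfolding L_def using assms(1,2) by (intro sum_pos) auto
  qed
  have L_remove: "L (A - {i}) = L A + l i" if "A \<subseteq> I" "i \<in> A" for A i
  proof -
    have "I - (A - {i}) = insert i (I - A)" using that by auto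
    then show ?thesis using that assms(1) by (simp add: L_def)
  qed
  have "J A (L A) * \<psi> (I - A) = (\<Sum>i\<in>A. l i / L (A - {i}) * J (A - {i}) (L (A - {i})) * \<psi> (I - (A - {i}) - {i}))"
    if A: "A \<subseteq> I" "card A = Suc m" for A
  proof -
    have "J A (L A) = (\<Sum>i\<in>A. l i / (L A + l i) * J (A - {i}) (L A + l i))"
      using A L by (intro J_rec) auto
    moreover have "I - (A - {i}) - {i} = I - A" if "i \<in> A" for i using that by auto
    ultimately show ?thesis using A by (simp add: sum_distrib_right L_remove)
  qed
  then have "(\<Sum>A | A \<subseteq> I \<and> card A = Suc m. J A (L A) * \<psi> (I - A)) =
    (\<Sum>A | A \<subseteq> I \<and> card A = Suc m. \<Sum>i\<in>A. l i / L (A - {i}) * J (A - {i}) (L (A - {i})) * \<psi> (I - (A - {i}) - {i}))"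
    by (intro sum.cong) auto
  also have "\<dots> = (\<Sum>A | A \<subseteq> I \<and> card A = m. \<Sum>i\<in>I - A. l i / L A * J A (L A) * \<psi> (I - A - {i}))"
    by (rule sum_subset_remove[OF assms(1)])
  also have "\<dots> = (\<Sum>A | A \<subseteq> I \<and> card A = m. J A (\<Sum>j\<in>I - A. l j) *
      (\<Sum>i\<in>I - A. l i / (\<Sum>j\<in>I - A. l j) * \<psi> (I - A - {i})))"
    by (simp add: sum_distrib_left L_def mult_ac)
  also have "\<dots> = (\<Sum>r\<in>draws I m. draw_weight I l r *
      (\<Sum>i\<in>I - set r. l i / (\<Sum>j\<in>I - set r. l j) * \<psi> (I - set r - {i})))"
    using Suc.IH[of "\<lambda>B. \<Sum>i\<in>B. l i / (\<Sum>j\<in>B. l j) * \<psi> (B - {i})"] Suc.prems by simp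
  also have "\<dots> = (\<Sum>r\<in>draws I (Suc m). draw_weight I l r * \<psi> (I - set r))"
    by (rule sum_draws_Suc[OF assms(1), symmetric])
  finally show ?case by (simp add: L_def)
qed

section \<open>The law of an exponential spacing\<close>

definition pattern_window :: "real \<Rightarrow> 'i set \<Rightarrow> 'i set \<Rightarrow> 'i \<Rightarrow> real \<Rightarrow> real set" where
  "pattern_window a A S j t = (if j \<in> A then {..<t} else if j \<in> S then {t<..t + a} else {t + a<..})"

text \<open>
The points at which \<open>A\<close> is the set of the indices before \<open>i\<close>, and \<open>S\<close> that of the indices within
distance \<open>a\<close> after \<open>i\<close>. The strict inequalities in \<open>pattern_window\<close> make these events disjoint
(\<open>disjoint_pattern_events\<close>); points with ties belong to none of them.
\<close>

definition pattern_event :: "'i set \<Rightarrow> ('i \<Rightarrow> real) \<Rightarrow> real \<Rightarrow> 'i set \<times> 'i \<times> 'i set \<Rightarrow> ('i \<Rightarrow> real) set" where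
  "pattern_event I l a = (\<lambda>(A, i, S). {x \<in> space (PiM I (\<lambda>i. exp_law (l i))).
     \<forall>j\<in>I - {i}. x j \<in> pattern_window a A S j (x i)})"

definition patterns :: "'i set \<Rightarrow> nat \<Rightarrow> (nat \<Rightarrow> bool) \<Rightarrow> ('i set \<times> 'i \<times> 'i set) set" where
  "patterns I m P = (SIGMA A:{A. A \<subseteq> I \<and> card A = m}. SIGMA i:I - A. {S. S \<subseteq> I - A - {i} \<and> P (card S)})"

lemma sets_pattern_window: "pattern_window a A S j t \<in> sets borel"
  by (simp add: pattern_window_def)

lemma sets_pattern_event:
  assumes "finite I" "i \<in> I"
  shows "pattern_event I l a (A, i, S) \<in> sets (PiM I (\<lambda>i. exp_law (l i)))"
proof -
  let ?P = "PiM I (\<lambda>i. exp_law (l i))"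
  have comp: "(\<lambda>x. x j) \<in> borel_measurable ?P" if "j \<in> I" for j
    using measurable_component_singleton[OF that, of "\<lambda>i. exp_law (l i)"] by (simp cong: measurable_cong_sets)
  have "{x \<in> space ?P. x j \<in> pattern_window a A S j (x i)} \<in> sets ?P" if j: "j \<in> I - {i}" for j
  proof -
    have ij: "(\<lambda>x. x j) \<in> borel_measurable ?P" "(\<lambda>x. x i) \<in> borel_measurable ?P"
      using comp j assms(2) by auto
    have ia: "(\<lambda>x. x i + a) \<in> borel_measurable ?P" by (intro borel_measurable_add ij borel_measurable_const)
    have "{x \<in> space ?P. x j < x i} \<in> sets ?P" "{x \<in> space ?P. x i < x j \<and> x j \<le> x i + a} \<in> sets ?P"
      "{x \<in> space ?P. x i + a < x j} \<in> sets ?P"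
      by (intro borel_measurable_less borel_measurable_le sets.sets_Collect_conj ij ia)+
    then show ?thesis by (cases "j \<in> A"; cases "j \<in> S") (simp_all add: pattern_window_def)
  qed
  then show ?thesis
    unfolding pattern_event_def prod.case using assms(1) by (intro sets.sets_Collect_finite_All) auto
qed

text \<open>
Given \<open>x i = t\<close>, the windows have probabilities \<open>1 - exp (- (l j * t))\<close> for \<open>j \<in> A\<close>, and
\<open>exp (- (l j * t))\<close> times a factor free of \<open>t\<close> for the other indices. The latter factors leave the integral,
which \<open>exp_law_tilt\<close> evaluates.
\<close>

lemma measure_pattern_event:
  assumes "finite I" "\<And>j. j \<in> I \<Longrightarrow> 0 < l j" "0 \<le> a"
    and A: "A \<subseteq> I" and i: "i \<in> I - A" and S: "S \<subseteq> I - A - {i}"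
  shows "measure (PiM I (\<lambda>i. exp_law (l i))) (pattern_event I l a (A, i, S)) =
    l i / (\<Sum>j\<in>I - A. l j) * all_earlier l A (\<Sum>j\<in>I - A. l j) *
    ((\<Prod>j\<in>S. 1 - exp (- (l j * a))) * (\<Prod>j\<in>I - A - {i} - S. exp (- (l j * a))))"
proof -
  define B where "B = I - A - {i}"
  define q where "q = (\<Prod>j\<in>S. 1 - exp (- (l j * a))) * (\<Prod>j\<in>B - S. exp (- (l j * a)))"
  define L where "L = (\<Sum>j\<in>B. l j)"
  define h where "h t = exp (- (L * t)) * ((\<Prod>j\<in>A. 1 - exp (- (l j * t))) * q)" for t
  have fin: "finite A" "finite S" "finite B" using assms by (auto simp: B_def intro: finite_subset)
  have "S \<subseteq> B" using S by (simp add: B_def)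
  have pos: "0 < l j" if "j \<in> A \<or> j \<in> B \<or> j \<in> S" for j using that assms by (auto simp: B_def)
  have "0 \<le> L" unfolding L_def using pos by (intro sum_nonneg) (auto simp: less_imp_le)
  have sumL: "(\<Sum>j\<in>I - A. l j) = l i + L"
    using assms(1) i by (simp add: L_def B_def sum.remove)
  have q: "0 \<le> q" "q \<le> 1"
  proof -
    show "0 \<le> q" unfolding q_def using pos assms(3) by (intro mult_nonneg_nonneg prod_nonneg) (auto simp: less_imp_le)
    show "q \<le> 1" unfolding q_def
      using pos assms(3) \<open>S \<subseteq> B\<close> by (intro mult_le_one prod_nonneg prod_le_1) (auto simp: less_imp_le)
  qed
  have h: "0 \<le> h t" "h t \<le> 1" if "0 \<le> t" for t
  proof -
    have "0 \<le> (\<Prod>j\<in>A. 1 - exp (- (l j * t)))" "(\<Prod>j\<in>A. 1 - exp (- (l j * t))) \<le> 1"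
      using prod_one_minus_exp_bound[of A l t] pos that by auto
    moreover have "exp (- (L * t)) \<le> 1" using \<open>0 \<le> L\<close> that by simp
    ultimately show "0 \<le> h t" "h t \<le> 1"
      unfolding h_def using q by (auto intro!: mult_nonneg_nonneg mult_le_one)
  qed
  have prod_meas: "(\<Prod>j\<in>I - {i}. emeasure (exp_law (l j)) (pattern_window a A S j t)) = ennreal (h t)"
    if t: "0 \<le> t" for t
  proof -
    let ?f = "\<lambda>j. measure (exp_law (l j)) (pattern_window a A S j t)"
    have fA: "?f j = 1 - exp (- (l j * t))" if "j \<in> A" for j
      using that pos t by (simp add: pattern_window_def measure_exp_law_lessThan)
    have fS: "?f j = exp (- (l j * t)) * (1 - exp (- (l j * a)))" if "j \<in> S" for j
      using that pos t assms(3) \<open>S \<subseteq> B\<close>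
      by (auto simp: pattern_window_def B_def measure_exp_law_greaterThanAtMost algebra_simps exp_add[symmetric])
    have fR: "?f j = exp (- (l j * t)) * exp (- (l j * a))" if "j \<in> B - S" for j
      using that pos t assms(3)
      by (auto simp: pattern_window_def B_def measure_exp_law_greaterThan algebra_simps exp_add[symmetric])
    have "I - {i} = A \<union> B" "A \<inter> B = {}" using A i by (auto simp: B_def)
    then have "(\<Prod>j\<in>I - {i}. ?f j) = (\<Prod>j\<in>A. ?f j) * (\<Prod>j\<in>B. ?f j)"
      using fin by (simp add: prod.union_disjoint)
    also have "(\<Prod>j\<in>B. ?f j) = (\<Prod>j\<in>S. ?f j) * (\<Prod>j\<in>B - S. ?f j)"
      using fin \<open>S \<subseteq> B\<close> by (subst prod.subset_diff) (auto simp: mult.commute)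
    also have "\<dots> = (\<Prod>j\<in>S. exp (- (l j * t)) * (1 - exp (- (l j * a)))) *
        (\<Prod>j\<in>B - S. exp (- (l j * t)) * exp (- (l j * a)))"
      by (intro arg_cong2[where f = "(*)"] prod.cong refl fS fR)
    also have "\<dots> = ((\<Prod>j\<in>B - S. exp (- (l j * t))) * (\<Prod>j\<in>S. exp (- (l j * t)))) * q"
      by (simp add: prod.distrib q_def mult_ac)
    also have "(\<Prod>j\<in>B - S. exp (- (l j * t))) * (\<Prod>j\<in>S. exp (- (l j * t))) = (\<Prod>j\<in>B. exp (- (l j * t)))"
      using fin \<open>S \<subseteq> B\<close> by (intro prod.subset_diff[symmetric])
    also have "\<dots> = exp (- (L * t))"
      using fin by (simp add: exp_sum[symmetric] L_def sum_negf sum_distrib_right)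
    also have "(\<Prod>j\<in>A. ?f j) = (\<Prod>j\<in>A. 1 - exp (- (l j * t)))"
      by (intro prod.cong refl fA)
    finally have "(\<Prod>j\<in>I - {i}. ?f j) = h t" by (simp add: h_def mult_ac)
    moreover have "emeasure (exp_law b) X = ennreal (measure (exp_law b) X)" for b X
      by (rule finite_measure.emeasure_eq_measure[OF prob_space.finite_measure[OF prob_space_exp_law]])
    ultimately show ?thesis by (simp add: prod_ennreal)
  qed
  let ?P = "PiM I (\<lambda>i. exp_law (l i))"
  have I: "I = insert i (I - {i})" using i by auto
  have "emeasure ?P (pattern_event I l a (A, i, S)) =
      (\<integral>\<^sup>+t. (\<Prod>j\<in>I - {i}. emeasure (exp_law (l j)) (pattern_window a A S j t)) \<partial>exp_law (l i))"
  proof -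
    have "i \<in> I" "finite (I - {i})" using i assms(1) by auto
    then show ?thesis
      using emeasure_PiM_exp_law_condition[of "I - {i}" i "pattern_window a A S" l, OF _ _ sets_pattern_window]
        sets_pattern_event[OF assms(1), of i l a A S]
      unfolding pattern_event_def prod.case I[symmetric] by blast
  qed
  also have "\<dots> = (\<integral>\<^sup>+t. ennreal (h t) \<partial>exp_law (l i))"
    by (rule nn_integral_cong_AE) (use AE_exp_law_pos[of "l i"] prod_meas in \<open>auto elim!: AE_mp\<close>)
  also have "\<dots> = ennreal (\<integral>t. h t \<partial>exp_law (l i))"
  proof (rule nn_integral_eq_integral)
    show "integrable (exp_law (l i)) h"
      by (rule integrable_exp_law_bounded) (use h in \<open>auto simp: h_def[abs_def]\<close>)
    show "AE t in exp_law (l i). 0 \<le> h t"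
      using AE_exp_law_pos[of "l i"] by eventually_elim (rule h)
  qed
  also have "(\<integral>t. h t \<partial>exp_law (l i)) = l i / (l i + L) * (\<integral>t. (\<Prod>j\<in>A. 1 - exp (- (l j * t))) * q \<partial>exp_law (l i + L))"
    unfolding h_def using assms i \<open>0 \<le> L\<close> by (intro exp_law_tilt) auto
  also have "\<dots> = l i / (l i + L) * all_earlier l A (l i + L) * q"
    by (simp add: all_earlier_def)
  finally have em: "emeasure ?P (pattern_event I l a (A, i, S)) = ennreal (l i / (l i + L) * all_earlier l A (l i + L) * q)" .
  have "0 \<le> all_earlier l A (l i + L)"
    unfolding all_earlier_def
  proof (rule integral_nonneg_AE)
    show "AE t in exp_law (l i + L). 0 \<le> (\<Prod>j\<in>A. 1 - exp (- (l j * t)))"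
      using AE_exp_law_pos[of "l i + L"] 
      by eventually_elim (intro prod_one_minus_exp_bound(1) pos, simp_all)
  qed
  then have "0 \<le> l i / (l i + L) * all_earlier l A (l i + L) * q"
    using assms(2)[of i] i \<open>0 \<le> L\<close> q by (intro mult_nonneg_nonneg divide_nonneg_nonneg) (auto simp: less_imp_le)
  then show ?thesis using em by (simp add: measure_def sumL q_def B_def)
qed

lemma finite_pattern_parts:
  assumes "finite I"
  shows "finite {A. A \<subseteq> I \<and> card A = m}" "finite {S. S \<subseteq> I - A - {i} \<and> P (card S)}"
    "finite (SIGMA i:I - A. {S. S \<subseteq> I - A - {i} \<and> P (card S)})"
proof -
  show "finite {A. A \<subseteq> I \<and> card A = m}"
    by (rule finite_subset[of _ "Pow I"]) (use assms in auto)
  show *: "finite {S. S \<subseteq> I - A - {i} \<and> P (card S)}" for i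
    by (rule finite_subset[of _ "Pow I"]) (use assms in auto)
  show "finite (SIGMA i:I - A. {S. S \<subseteq> I - A - {i} \<and> P (card S)})"
    by (rule finite_SigmaI) (use assms * in auto)
qed

lemma sum_patterns:
  assumes "finite I"
  shows "(\<Sum>\<tau>\<in>patterns I m P. f \<tau>) = (\<Sum>A | A \<subseteq> I \<and> card A = m. \<Sum>i\<in>I - A. \<Sum>S | S \<subseteq> I - A - {i} \<and> P (card S). f (A, i, S))"
proof -
  note fin = finite_pattern_parts[OF assms]
  have "(\<Sum>\<tau>\<in>patterns I m P. f \<tau>) =
      (\<Sum>A | A \<subseteq> I \<and> card A = m. \<Sum>z\<in>(SIGMA i:I - A. {S. S \<subseteq> I - A - {i} \<and> P (card S)}). f (A, z))"
    unfolding patterns_def using fin(1,3) by (subst sum.Sigma) (simp_all only: case_prod_eta simp_thms ball_triv)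
  also have "\<dots> = (\<Sum>A | A \<subseteq> I \<and> card A = m. \<Sum>i\<in>I - A. \<Sum>S | S \<subseteq> I - A - {i} \<and> P (card S). f (A, i, S))"
  proof (intro sum.cong refl)
    fix A
    show "(\<Sum>z\<in>(SIGMA i:I - A. {S. S \<subseteq> I - A - {i} \<and> P (card S)}). f (A, z)) =
        (\<Sum>i\<in>I - A. \<Sum>S | S \<subseteq> I - A - {i} \<and> P (card S). f (A, i, S))"
      using sum.Sigma[of "I - A" "\<lambda>i. {S. S \<subseteq> I - A - {i} \<and> P (card S)}" "\<lambda>i S. f (A, i, S)"] fin(2)[of A] assms
      by (simp add: case_prod_unfold)
  qed
  finally show ?thesis .
qed

lemma finite_patterns:
  assumes "finite I"
  shows "finite (patterns I m P)"
  unfolding patterns_def by (rule finite_SigmaI) (use finite_pattern_parts[OF assms] in blast)+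

text \<open>
The sum over \<open>S\<close> produces \<open>order_cdf\<close> for the indices after \<open>i\<close>. The sum over \<open>A\<close> and \<open>i\<close> is then one over
the \<open>m\<close> earliest indices and the next one, which \<open>sum_first_drawn\<close> rewrites in terms of ordered draws.
\<close>

lemma sum_measure_patterns:
  assumes "finite I" "\<And>j. j \<in> I \<Longrightarrow> 0 < l j" "0 \<le> a" "m < card I"
  shows "(\<Sum>\<tau>\<in>patterns I m (\<lambda>s. p \<le> s). measure (PiM I (\<lambda>i. exp_law (l i))) (pattern_event I l a \<tau>)) =
    (\<Sum>r\<in>draws I (Suc m). draw_weight I l r * order_cdf p (I - set r) l a)"
proof -
  let ?P = "PiM I (\<lambda>i. exp_law (l i))"
  define L where "L B = (\<Sum>j\<in>B. l j)" for B
  have "(\<Sum>\<tau>\<in>patterns I m (\<lambda>s. p \<le> s). measure ?P (pattern_event I l a \<tau>)) =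
    (\<Sum>A | A \<subseteq> I \<and> card A = m. \<Sum>i\<in>I - A. \<Sum>S | S \<subseteq> I - A - {i} \<and> p \<le> card S.
      measure ?P (pattern_event I l a (A, i, S)))"
    by (rule sum_patterns[OF assms(1)])
  also have "\<dots> = (\<Sum>A | A \<subseteq> I \<and> card A = m. \<Sum>i\<in>I - A. \<Sum>S | S \<subseteq> I - A - {i} \<and> p \<le> card S.
      l i / L (I - A) * all_earlier l A (L (I - A)) *
    ((\<Prod>j\<in>S. 1 - exp (- (l j * a))) * (\<Prod>j\<in>I - A - {i} - S. exp (- (l j * a)))))"
    unfolding L_def using assms by (intro sum.cong refl measure_pattern_event) auto
  also have "\<dots> = (\<Sum>A | A \<subseteq> I \<and> card A = m. \<Sum>i\<in>I - A. 
      l i / L (I - A) * all_earlier l A (L (I - A)) * order_cdf p (I - A - {i}) l a)"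
    unfolding order_cdf_def sum_distrib_left ..
  also have "\<dots> = (\<Sum>A | A \<subseteq> I \<and> card A = m. all_earlier l A (\<Sum>j\<in>I - A. l j) *
      (\<Sum>i\<in>I - A. l i / L (I - A) * order_cdf p (I - A - {i}) l a))"
    by (simp add: sum_distrib_left L_def mult_ac)
  also have "\<dots> = (\<Sum>r\<in>draws I m. draw_weight I l r *
      (\<Sum>i\<in>I - set r. l i / L (I - set r) * order_cdf p (I - set r - {i}) l a))"
  proof (rule sum_first_drawn[where \<psi> = "\<lambda>B. \<Sum>i\<in>B. l i / L B * order_cdf p (B - {i}) l a"])
    fix A b assume "A \<subseteq> I" "A \<noteq> {}" "0 < (b :: real)"
    then show "all_earlier l A b = (\<Sum>i\<in>A. l i / (b + l i) * all_earlier l (A - {i}) (b + l i))"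
      using all_earlier_last[of A l b] assms by (auto intro: finite_subset)
  qed (use assms all_earlier_empty in auto)
  also have "\<dots> = (\<Sum>r\<in>draws I (Suc m). draw_weight I l r * order_cdf p (I - set r) l a)"
    unfolding L_def by (rule sum_draws_Suc[OF assms(1), symmetric])
  finally show ?thesis .
qed

lemma pattern_eventD:
  assumes "x \<in> pattern_event I l a (A, i, S)" "0 \<le> a" "i \<in> I - A" "A \<subseteq> I" "S \<subseteq> I - A - {i}"
  shows "\<And>j. j \<in> A \<Longrightarrow> x j < x i"
    and "\<And>j. j \<in> S \<Longrightarrow> x i < x j \<and> x j \<le> x i + a"
    and "\<And>j. j \<in> I - A - {i} - S \<Longrightarrow> x i + a < x j"
proof -
  have w: "x j \<in> pattern_window a A S j (x i)" if "j \<in> I - {i}" for j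
    using assms(1) that by (simp add: pattern_event_def)
  show "x j < x i" if "j \<in> A" for j
  proof -
    have "j \<in> I - {i}" using that assms by blast
    then show ?thesis using w[of j] that by (simp add: pattern_window_def)
  qed
  show "x i < x j \<and> x j \<le> x i + a" if "j \<in> S" for j
  proof -
    have "j \<in> I - {i}" "j \<notin> A" using that assms by blast+
    then show ?thesis using w[of j] that by (simp add: pattern_window_def)
  qed
  show "x i + a < x j" if "j \<in> I - A - {i} - S" for j
    using w[of j] that by (simp add: pattern_window_def)
qed

lemma pattern_event_greater:
  assumes "x \<in> pattern_event I l a (A, i, S)" "0 \<le> a" "i \<in> I - A" "A \<subseteq> I" "S \<subseteq> I - A - {i}"
    and j: "j \<in> I - A - {i}"
  shows "x i < x j"
proof (cases "j \<in> S")
  case True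
  then show ?thesis using pattern_eventD(2)[OF assms(1-5)] by blast
next
  case False
  then have "x i + a < x j" using pattern_eventD(3)[OF assms(1-5)] j by blast
  then show ?thesis using assms(2) by linarith
qed

lemma pattern_event_earlier:
  assumes "x \<in> pattern_event I l a (A, i, S)" "0 \<le> a" "i \<in> I - A" "A \<subseteq> I" "S \<subseteq> I - A - {i}"
  shows "A = {j \<in> I. x j < x i}"
proof (intro set_eqI iffI)
  fix j assume "j \<in> A"
  then show "j \<in> {j \<in> I. x j < x i}" using pattern_eventD(1)[OF assms] assms(4) by blast
next
  fix j assume j: "j \<in> {j \<in> I. x j < x i}"
  then have "\<not> x i < x j" "j \<noteq> i" by auto
  then show "j \<in> A" using pattern_event_greater[OF assms, of j] j by blast
qed

lemma pattern_event_unique: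
  assumes "finite I" "0 \<le> a"
    and x: "x \<in> pattern_event I l a (A, i, S)" and S: "i \<in> I - A" "A \<subseteq> I" "S \<subseteq> I - A - {i}"
    and x': "x \<in> pattern_event I l a (A', i', S')" and S': "i' \<in> I - A'" "A' \<subseteq> I" "S' \<subseteq> I - A' - {i'}"
    and card: "card A = card A'"
  shows "A = A'" "i = i'" "S = S'"
proof -
  note A = pattern_event_earlier[OF x assms(2) S]
  note A' = pattern_event_earlier[OF x' assms(2) S']
  have fin: "finite A" "finite A'" using S S' assms(1) finite_subset by blast+
  have "\<not> x i < x i'"
  proof
    assume lt: "x i < x i'"
    have "insert i A \<subseteq> A'" by (subst A, subst A') (use S(1) lt in auto)
    then have "card (insert i A) \<le> card A'" by (rule card_mono[OF fin(2)])
    then show False using S(1) fin card by simp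
  qed
  moreover have "\<not> x i' < x i"
  proof
    assume lt: "x i' < x i"
    have "insert i' A' \<subseteq> A" by (subst A, subst A') (use S'(1) lt in auto)
    then have "card (insert i' A') \<le> card A" by (rule card_mono[OF fin(1)])
    then show False using S'(1) fin card by simp
  qed
  ultimately have eq: "x i = x i'" by simp
  show "A = A'" by (subst A, subst A') (simp only: eq)
  then show "i = i'" using pattern_event_greater[OF x assms(2) S, of i'] S' eq by auto
  show "S = S'"
  proof (intro set_eqI iffI)
    fix j assume j: "j \<in> S"
    then have "x j \<le> x i + a" "j \<in> I - A - {i}" using pattern_eventD(2)[OF x assms(2) S] S(3) by auto
    then show "j \<in> S'"
      using pattern_eventD(3)[OF x' assms(2) S', of j] \<open>A = A'\<close> \<open>i = i'\<close> by (meson DiffI leD)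
  next
    fix j assume j: "j \<in> S'"
    then have "x j \<le> x i' + a" "j \<in> I - A' - {i'}" using pattern_eventD(2)[OF x' assms(2) S'] S'(3) by auto
    then show "j \<in> S"
      using pattern_eventD(3)[OF x assms(2) S, of j] \<open>A = A'\<close> \<open>i = i'\<close> by (meson DiffI leD)
  qed
qed

lemma disjoint_pattern_events:
  assumes "finite I" "0 \<le> a"
  shows "disjoint_family_on (pattern_event I l a) (patterns I m P)"
  unfolding disjoint_family_on_def
proof (intro ballI impI)
  fix \<sigma> \<tau> assume st: "\<sigma> \<in> patterns I m P" "\<tau> \<in> patterns I m P" "\<sigma> \<noteq> \<tau>"
  obtain A i S where s: "\<sigma> = (A, i, S)" by (cases \<sigma>) auto
  obtain A' i' S' where t: "\<tau> = (A', i', S')" by (cases \<tau>) auto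
  have S: "card A = m" "i \<in> I - A" "A \<subseteq> I" "S \<subseteq> I - A - {i}"
    and T: "card A' = m" "i' \<in> I - A'" "A' \<subseteq> I" "S' \<subseteq> I - A' - {i'}"
    using st by (auto simp: s t patterns_def)
  have False if "x \<in> pattern_event I l a \<sigma>" "x \<in> pattern_event I l a \<tau>" for x
    using pattern_event_unique[OF assms that(1)[unfolded s] S(2-4) that(2)[unfolded t] T(2-4)] S(1) T(1) st(3)
    by (simp add: s t)
  then show "pattern_event I l a \<sigma> \<inter> pattern_event I l a \<tau> = {}" by blast
qed

lemma prob_space_PiM_exp_law: "prob_space (PiM I (\<lambda>i. exp_law (l i)))"
  by (intro prob_space_PiM prob_space_exp_law)

text \<open>
Every pattern event lies either inside the event in question or inside its complement, according to
the size of \<open>S\<close>. The probabilities of all pattern events add up to \<open>1\<close>, so both inclusions are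
exact up to a null set; in particular ties need no separate treatment.
\<close>

lemma measure_spacing_le:
  assumes "1 \<le> m" "m < k" "k \<le> n" "\<And>i. i \<in> {1..n} \<Longrightarrow> 0 < l i" "0 \<le> a"
  shows "measure (PiM {1..n} (\<lambda>i. exp_law (l i)))
      {x \<in> space (PiM {1..n} (\<lambda>i. exp_law (l i))). order_statistic k n x - order_statistic m n x \<le> a} =
    (\<Sum>r\<in>draws {1..n} m. draw_weight {1..n} l r * order_cdf (k - m) ({1..n} - set r) l a)"
proof -
  let ?I = "{1..n}" and ?P = "PiM {1..n} (\<lambda>i. exp_law (l i))"
  let ?E = "{x \<in> space ?P. order_statistic k n x - order_statistic m n x \<le> a}"
  interpret prob_space ?P by (rule prob_space_PiM_exp_law)
  define all good where "all = patterns ?I (m - 1) (\<lambda>s. 0 \<le> s)" and "good = patterns ?I (m - 1) (\<lambda>s. k - m \<le> s)"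
  have "good \<subseteq> all" by (auto simp: all_def good_def patterns_def)
  have fin: "finite all" by (simp add: all_def finite_patterns)
  have iff: "x \<in> ?E \<longleftrightarrow> \<tau> \<in> good" if "\<tau> \<in> all" "x \<in> pattern_event ?I l a \<tau>" for x \<tau>
  proof -
    obtain A i S where t: "\<tau> = (A, i, S)" by (cases \<tau>) auto
    have T: "A \<subseteq> ?I" "card A = m - 1" "i \<in> ?I - A" "S \<subseteq> ?I - A - {i}"
      using that by (auto simp: t all_def patterns_def)
    note x = pattern_eventD[OF that(2)[unfolded t] assms(5) T(3,1,4)]
    have "order_statistic k n x - order_statistic m n x \<le> a \<longleftrightarrow> k - m \<le> card S"
      by (rule order_statistic_spacing_le_iff[where A = A and i = i and x = x, OF assms(1-3,5) T])
        (fact x)+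
    moreover have "x \<in> space ?P" using that by (simp add: t pattern_event_def)
    moreover have "\<tau> \<in> good \<longleftrightarrow> k - m \<le> card S" using T by (auto simp: t good_def patterns_def)
    ultimately show ?thesis by simp
  qed
  have comp: "(\<lambda>x. x j) \<in> borel_measurable ?P" if "j \<in> ?I" for j
    using measurable_component_singleton[OF that, of "\<lambda>i. exp_law (l i)"] by (simp cong: measurable_cong_sets)
  have E: "?E \<in> events"
    using assms(1-3) comp
    by (intro borel_measurable_le borel_measurable_diff borel_measurable_order_statistic borel_measurable_const) auto
  have sets: "pattern_event ?I l a \<tau> \<in> events" if "\<tau> \<in> all" for \<tau>
  proof -
    obtain A i S where t: "\<tau> = (A, i, S)" by (cases \<tau>) auto
    then have "i \<in> ?I" using that by (auto simp: all_def patterns_def)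
    then show ?thesis unfolding t by (intro sets_pattern_event) simp
  qed
  have union: "prob (\<Union>\<tau>\<in>T. pattern_event ?I l a \<tau>) = (\<Sum>\<tau>\<in>T. prob (pattern_event ?I l a \<tau>))" if "T \<subseteq> all" for T
    using that fin sets disjoint_pattern_events[of ?I a l "m - 1" "\<lambda>s. 0 \<le> s"] assms(5)
    by (intro finite_measure_finite_Union) (auto simp: all_def intro: finite_subset disjoint_family_on_mono)
  have m: "Suc (m - 1) = m" "m - 1 < card ?I" using assms by auto
  have sum: "(\<Sum>\<tau>\<in>patterns ?I (m - 1) (\<lambda>s. p \<le> s). prob (pattern_event ?I l a \<tau>)) =
    (\<Sum>r\<in>draws ?I m. draw_weight ?I l r * order_cdf p (?I - set r) l a)" for p
    using sum_measure_patterns[of ?I l a "m - 1" p] assms m by simp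
  have "(\<Sum>\<tau>\<in>all. prob (pattern_event ?I l a \<tau>)) = (\<Sum>r\<in>draws ?I m. draw_weight ?I l r)"
    unfolding all_def sum by (simp add: order_cdf_0)
  also have "\<dots> = 1" using assms by (intro sum_draw_weight) auto
  finally have all: "(\<Sum>\<tau>\<in>all. prob (pattern_event ?I l a \<tau>)) = 1" .
  have "(\<Sum>\<tau>\<in>good. prob (pattern_event ?I l a \<tau>)) \<le> prob ?E"
  proof -
    have "(\<Union>\<tau>\<in>good. pattern_event ?I l a \<tau>) \<subseteq> ?E" using iff \<open>good \<subseteq> all\<close> by blast
    then have "prob (\<Union>\<tau>\<in>good. pattern_event ?I l a \<tau>) \<le> prob ?E" by (intro finite_measure_mono E)
    then show ?thesis using union[OF \<open>good \<subseteq> all\<close>] by simp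
  qed
  moreover have "(\<Sum>\<tau>\<in>all - good. prob (pattern_event ?I l a \<tau>)) \<le> prob (space ?P - ?E)"
  proof -
    have sub: "x \<in> space ?P - ?E" if "\<tau> \<in> all - good" "x \<in> pattern_event ?I l a \<tau>" for x \<tau>
      using iff[of \<tau> x] that by (cases \<tau>) (auto simp: pattern_event_def)
    have "prob (\<Union>\<tau>\<in>all - good. pattern_event ?I l a \<tau>) \<le> prob (space ?P - ?E)"
      using sub E by (intro finite_measure_mono sets.compl_sets) blast+
    then show ?thesis using union[of "all - good"] by simp
  qed
  moreover have "(\<Sum>\<tau>\<in>all. prob (pattern_event ?I l a \<tau>)) =
      (\<Sum>\<tau>\<in>all - good. prob (pattern_event ?I l a \<tau>)) + (\<Sum>\<tau>\<in>good. prob (pattern_event ?I l a \<tau>))"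
    by (rule sum.subset_diff[OF \<open>good \<subseteq> all\<close> fin])
  ultimately have "prob ?E = (\<Sum>\<tau>\<in>good. prob (pattern_event ?I l a \<tau>))"
    using all prob_compl[OF E] by linarith
  then show ?thesis unfolding good_def sum .
qed

text \<open>
Independence identifies the joint law of the sample with the product of exponential laws, of which
the spacing is a function.
\<close>

lemma cdf_exponential_spacing:
  fixes X :: "nat \<Rightarrow> 'a \<Rightarrow> real"
  assumes "1 \<le> m" "m < k" "k \<le> n" and pos: "\<And>i. i \<in> {1..n} \<Longrightarrow> 0 < l i"
    and "prob_space M" and indep: "prob_space.indep_vars M (\<lambda>_. borel) X {1..n}"
    and dist: "\<And>i. i \<in> {1..n} \<Longrightarrow> distributed M lborel (X i) (exponential_density (l i))"
  shows "cdf (distr M borel (\<lambda>\<omega>. order_statistic k n (\<lambda>i. X i \<omega>) - order_statistic m n (\<lambda>i. X i \<omega>))) a =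
    (if a < 0 then 0 else
      \<Sum>r\<in>draws {1..n} m. draw_weight {1..n} l r * order_cdf (k - m) ({1..n} - set r) l a)"
proof -
  interpret prob_space M by fact
  let ?I = "{1..n}" and ?P = "PiM {1..n} (\<lambda>i. exp_law (l i))"
  define D where "D x = order_statistic k n x - order_statistic m n x" for x :: "nat \<Rightarrow> real"
  have X: "X i \<in> borel_measurable M" if "i \<in> ?I" for i
    using distributed_measurable[OF dist[OF that]] by simp
  have mD: "(\<lambda>\<omega>. D (\<lambda>i. X i \<omega>)) \<in> borel_measurable M"
    unfolding D_def using assms(1-3) X
    by (intro borel_measurable_diff borel_measurable_order_statistic) auto
  have cdf: "cdf (distr M borel (\<lambda>\<omega>. D (\<lambda>i. X i \<omega>))) a = prob {\<omega> \<in> space M. D (\<lambda>i. X i \<omega>) \<le> a}"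
    unfolding cdf_def using mD by (subst measure_distr) (auto intro!: arg_cong[where f = prob])
  show ?thesis
  proof (cases "a < 0")
    case True
    have "\<not> D x \<le> a" for x
      using order_statistic_mono[of m k n x] assms(1-3) True by (simp add: D_def)
    then show ?thesis using cdf True by (simp add: D_def)
  next
    case False
    have "distr M borel (X i) = exp_law (l i)" if "i \<in> ?I" for i
    proof -
      have "distr M borel (X i) = distr M lborel (X i)" by (rule distr_cong) auto
      then show ?thesis using distributed_distr_eq_density[OF dist[OF that]] pos[OF that] by (simp add: exp_law_pos)
    qed
    then have "PiM ?I (\<lambda>i. distr M borel (X i)) = ?P" by (intro PiM_cong) auto
    moreover have "?I \<noteq> {}" using assms(1-3) by auto
    ultimately have P: "distr M (PiM ?I (\<lambda>_. borel)) (\<lambda>\<omega>. \<lambda>i\<in>?I. X i \<omega>) = ?P"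
      using indep_vars_iff_distr_eq_PiM'[of ?I X "\<lambda>_. borel"] X indep by simp
    have sp: "space ?P = space (PiM ?I (\<lambda>_. borel :: real measure))" by (simp add: space_PiM)
    have meas: "(\<lambda>\<omega>. \<lambda>i\<in>?I. X i \<omega>) \<in> measurable M (PiM ?I (\<lambda>_. borel))"
      using X by (intro measurable_restrict)
    have comp: "(\<lambda>x. x j) \<in> borel_measurable (PiM ?I (\<lambda>_. borel :: real measure))" if "j \<in> ?I" for j
      using measurable_component_singleton[OF that, of "\<lambda>_. borel :: real measure"] .
    have E: "{x \<in> space (PiM ?I (\<lambda>_. borel)). D x \<le> a} \<in> sets (PiM ?I (\<lambda>_. borel))"
      unfolding D_def using assms(1-3) comp
      by (intro borel_measurable_le borel_measurable_diff borel_measurable_order_statistic borel_measurable_const) auto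
    have "D (\<lambda>i\<in>?I. X i \<omega>) = D (\<lambda>i. X i \<omega>)" for \<omega>
      unfolding D_def by (intro arg_cong2[where f = "(-)"] order_statistic_cong) auto
    then have "(\<lambda>\<omega>. \<lambda>i\<in>?I. X i \<omega>) -` {x \<in> space (PiM ?I (\<lambda>_. borel)). D x \<le> a} \<inter> space M
        = {\<omega> \<in> space M. D (\<lambda>i. X i \<omega>) \<le> a}"
      by (auto simp: space_PiM)
    then have "measure ?P {x \<in> space ?P. D x \<le> a} = prob {\<omega> \<in> space M. D (\<lambda>i. X i \<omega>) \<le> a}"
      unfolding sp P[symmetric] using measure_distr[OF meas E] by simp
    moreover have "measure ?P {x \<in> space ?P. D x \<le> a} =
        (\<Sum>r\<in>draws ?I m. draw_weight ?I l r * order_cdf (k - m) (?I - set r) l a)"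
      unfolding D_def using measure_spacing_le[OF assms(1-3) pos] False by simp
    ultimately show ?thesis using cdf False by (simp add: D_def)
  qed
qed

section \<open>The comparison theorem\<close>

theorem proposition1:
  fixes n m k :: nat
    and l :: "nat \<Rightarrow> real" and g :: real
    and M :: "'a measure" and X :: "nat \<Rightarrow> 'a \<Rightarrow> real"
    and N :: "'b measure" and Y :: "nat \<Rightarrow> 'b \<Rightarrow> real"
    and le_order :: "real measure \<Rightarrow> real measure \<Rightarrow> bool"
  assumes "1 \<le> m" and "m < k" and "k \<le> n"
    and "\<And>i. i \<in> {1..n} \<Longrightarrow> 0 < l i" and "0 < g"
    and "prob_space M"
    and "prob_space.indep_vars M (\<lambda>_. borel) X {1..n}"
    and "\<And>i. i \<in> {1..n} \<Longrightarrow> distributed M lborel (X i) (exponential_density (l i))"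
    and "prob_space N"
    and "prob_space.indep_vars N (\<lambda>_. borel) Y {1..n}"
    and "\<And>i. i \<in> {1..n} \<Longrightarrow> distributed N lborel (Y i) (exponential_density g)"
    and "le_order \<in> {st_order, hr_order, disp_order}"
  shows "le_order
      (distr N borel (\<lambda>\<omega>. order_statistic k n (\<lambda>i. Y i \<omega>) - order_statistic m n (\<lambda>i. Y i \<omega>)))
      (distr M borel (\<lambda>\<omega>. order_statistic k n (\<lambda>i. X i \<omega>) - order_statistic m n (\<lambda>i. X i \<omega>)))
    \<longleftrightarrow>
      real ((n - m) choose (k - m)) * g ^ (k - m)
        \<ge> (\<Sum>r | length r = m \<and> distinct r \<and> set r \<subseteq> {1..n}.
             elem_sym (k - m) ({1..n} - set r) l
               * (\<Prod>j<m. l (r ! j) / ((\<Sum>i=1..n. l i) - (\<Sum>i<j. l (r ! i)))))"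
proof -
  let ?I = "{1..n}"
  let ?\<mu> = "distr N borel (\<lambda>\<omega>. order_statistic k n (\<lambda>i. Y i \<omega>) - order_statistic m n (\<lambda>i. Y i \<omega>))"
  let ?\<nu> = "distr M borel (\<lambda>\<omega>. order_statistic k n (\<lambda>i. X i \<omega>) - order_statistic m n (\<lambda>i. X i \<omega>))"
  define p q where "p = k - m - 1" and "q = n - m - 1"
  have pq: "k - m = Suc p" "n - m = Suc q" "p \<le> q" using assms(1-3) by (auto simp: p_def q_def)
  define w where "w = draw_weight ?I l"
  define F where "F x = (\<Sum>r\<in>draws ?I m. w r * order_cdf (Suc p) (?I - set r) l x)" for x
  define s where "s = (\<Sum>r\<in>draws ?I m. w r * elem_sym (Suc p) (?I - set r) l)"
  have card: "card (?I - set r) = Suc q" if "r \<in> draws ?I m" for r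
    using card_draws_remainder[OF _ that] pq by simp
  have pos: "0 < l i" if "i \<in> ?I - set r" for i r using that assms(4) by blast
  have finI: "finite (?I - set r)" for r by simp
  have fin: "finite (draws ?I m)" by (rule finite_draws) simp
  have w_pos: "0 < w r" if "r \<in> draws ?I m" for r
    unfolding w_def by (rule draw_weight_pos[OF _ _ that]) (use assms(4) in auto)
  have w_1: "(\<Sum>r\<in>draws ?I m. w r) = 1"
    unfolding w_def by (rule sum_draw_weight) (use assms in auto)
  then have ne: "draws ?I m \<noteq> {}" by auto
  have range: "0 < order_cdf (Suc p) (?I - set r) l x \<and> order_cdf (Suc p) (?I - set r) l x < 1"
    if "r \<in> draws ?I m" "0 < x" for r x
    using card[OF that(1)] pq(3) that(2)
    by (intro conjI order_cdf_pos order_cdf_less_1 finI pos) auto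
  interpret star_comparison p q g s F ?\<mu> ?\<nu>
  proof
    show "p \<le> q" "0 < g" by (fact pq assms)+
    show "star_above F (hom_cdf (Suc p) (Suc q))"
      unfolding F_def
    proof (rule star_above_mixture[OF fin pq(3)])
      fix r assume "r \<in> draws ?I m"
      then show "star_above (order_cdf (Suc p) (?I - set r) l) (hom_cdf (Suc p) (Suc q))"
        using card pq by (intro order_cdf_star finI pos) auto
    qed (use w_pos w_1 range in \<open>auto simp: less_imp_le\<close>)
    show "0 < F x \<and> F x < 1" if "0 < x" for x
    proof
      show "0 < F x" unfolding F_def using range[OF _ that] w_pos by (intro sum_pos fin ne mult_pos_pos) auto
      have "F x < (\<Sum>r\<in>draws ?I m. w r * 1)"
        unfolding F_def using range[OF _ that] w_pos by (intro sum_strict_mono fin ne mult_strict_left_mono) auto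
      then show "F x < 1" using w_1 by simp
    qed
    show "F 0 = 0" by (simp add: F_def order_cdf_at_0)
    show "F x < F y" if "0 \<le> x" "x < y" for x y
      unfolding F_def
    proof (intro sum_strict_mono fin ne mult_strict_left_mono w_pos)
      fix r assume "r \<in> draws ?I m"
      then show "order_cdf (Suc p) (?I - set r) l x < order_cdf (Suc p) (?I - set r) l y"
        using card pq that by (intro order_cdf_strict_mono finI pos) auto
    qed
    show "continuous_on UNIV F"
      unfolding F_def by (intro continuous_intros continuous_on_order_cdf finI)
    have "(F \<longlongrightarrow> (\<Sum>r\<in>draws ?I m. w r * 1)) at_top"
      unfolding F_def using card pq by (intro tendsto_intros order_cdf_tendsto_1 finI pos) auto
    then show "(F \<longlongrightarrow> 1) at_top" using w_1 by simp
    show "((\<lambda>x. F x / x ^ Suc p) \<longlongrightarrow> s) (at_right 0)"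
      unfolding F_def s_def sum_divide_distrib times_divide_eq_right[symmetric]
      by (intro tendsto_intros order_cdf_asymptotics finI)
    show "cdf ?\<nu> x = (if x < 0 then 0 else F x)" for x
      using cdf_exponential_spacing[OF assms(1-4,6-8), of x] by (simp add: F_def w_def pq)
    show "cdf ?\<mu> x = (if x < 0 then 0 else hom_cdf (Suc p) (Suc q) (g * x))" for x
    proof -
      have "(\<Sum>r\<in>draws ?I m. draw_weight ?I (\<lambda>_. g) r * order_cdf (k - m) (?I - set r) (\<lambda>_. g) x)
          = (\<Sum>r\<in>draws ?I m. draw_weight ?I (\<lambda>_. g) r) * hom_cdf (Suc p) (Suc q) (g * x)"
        unfolding sum_distrib_right by (intro sum.cong refl) (simp only: order_cdf_homogeneous[OF finI] card pq)
      also have "(\<Sum>r\<in>draws ?I m. draw_weight ?I (\<lambda>_. g) r) = 1"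
        by (rule sum_draw_weight) (use assms in auto)
      finally show ?thesis
        using cdf_exponential_spacing[OF assms(1-3) assms(5) assms(9-11), of x] by simp
    qed
  qed
  have "s = (\<Sum>r | length r = m \<and> distinct r \<and> set r \<subseteq> ?I.
             elem_sym (k - m) (?I - set r) l
               * (\<Prod>j<m. l (r ! j) / ((\<Sum>i=1..n. l i) - (\<Sum>i<j. l (r ! i)))))"
    unfolding s_def draws_def w_def
    by (intro sum.cong refl) (simp add: draw_weight_def pq mult.commute)
  then show ?thesis
    using order_iff[OF assms(12)] by (simp only: pq)
qed

end
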